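(* Let $m\ge 1$, let $L$ be an $m$-component framed oriented link in $S^3$ (with components numbered $1,\dots,m$), and let $S=(s_{ij})_{i,j}$ be a symmetric matrix of size $m$ with coefficients in $\mathbb{N}=\{0,1,2,\dots\}$. For $i\neq j$ let $\ell_{ij}(L)$ be the linking number of the $i$th and $j$th components of $L$, and let $\ell_{ii}(L)=\frac12 fr_i(L)$ be half the framing of the $i$th component. Then $$\ell_S(L):=\prod_{1\le i\le j\le m}\frac{1}{s_{ij}!}\,\ell_{ij}(L)^{s_{ij}}=\sum_{D\in\mathcal{D}_S(m)}C_L[D],$$ where $\mathcal{D}_S(m)$ is the set of all chord diagrams on $m$ circles with exactly $s_{ij}$ chords of type $(i,j)$ for all $i,j$, and $C_L[D]$ denotes the coefficient of the chord diagram $D$ in the framed Kontsevich integral $Z(L)$.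
   Context: Chord diagrams. A chord diagram on $m$ circles is a collection of finitely many chords (copies of the unit interval) whose endpoints are pairwise distinct points on the disjoint union of $m$ oriented circles numbered $1,\dots,m$, considered up to orientation-preserving homeomorphism preserving each circle. Its degree is its number of chords. A type $(i,j)$ chord is a chord whose endpoints sit on circles $i$ and $j$ (a type $(i,i)$ chord has both endpoints on circle $i$). $\mathcal{A}(m)$ is the $\mathbb{Q}$-vector space (completed by degree) generated by chord diagrams on $m$ circles modulo the 4T relation: for any three disjoint oriented arcs $p,q,r$ of the circles, $t_{pq}t_{pr}-t_{pr}t_{pq}+t_{pq}t_{qr}-t_{qr}t_{pq}=0$, where $t_{xy}t_{zw}$ denotes a diagram having, on these arcs, a chord joining $x,y$ and a chord joining $z,w$, stacked in the given order along the orientation, the four diagrams being identical elsewhere. The same definitions apply to diagrams on any oriented 1-manifold. Coefficients. $C[D](A)$ denotes the coefficient of $D$ in $A\in\mathcal{A}(m)$, and $C_L[D]:=C[D](Z(L))$. An individual coefficient is in general not well defined because of the 4T relation; a sum $\sum_{D\in\mathcal{D}}C[D]$ is understood as the linear functional sending a chord diagram to $1$ if it lies in $\mathcal{D}$ and to $0$ otherwise, evaluated on any representative; it is well defined on $\mathcal{A}(m)$ when it vanishes on all 4T relators, which is the case for $\mathcal{D}=\mathcal{D}_S(m)$. Framed Kontsevich integral $Z$ (Le–Murakami). A framed q-tangle is a framed oriented tangle with a parenthesization on both sets of boundary points; each decomposes, under composition and juxtaposition, into elementary q-tangles: $I$ (trivial strand), $X_\pm$ (positive/negative crossing of two upward strands),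 $C_\pm$ (cap and cup), $\Lambda_\pm$ (change of parenthesization of trivial strands), and those obtained by reversing orientations of components. $Z$ is the multiplicative invariant with values in spaces of chord diagrams on the underlying 1-manifolds determined by: $Z(I)$ is the strand without chords; $Z(X_\pm)=\sum_{k\ge0}\frac{(\pm1)^k}{2^kk!}X_k$, where $X_k$ consists of the two crossing strands joined by $k$ parallel chords; $Z(C_\pm)=\sqrt{\nu}$; $Z(\Lambda_\pm)=\Phi^{\pm1}$ with $\Phi$ a Drinfeld associator (with the usual cabling of strands; the value on links is independent of its choice). Reversing the orientation of a strand reverses it in the diagrams and multiplies by $(-1)^{\#\text{chord endpoints on it}}$. Here $\nu=Z(U_0)\in\mathcal{A}(1)$ is the value on the $0$-framed unknot, $\nu=\chi\big(\exp_\sqcup(\sum_{n\ge1}b_{2n}W_{2n})\big)$, where $W_{2n}$ is the wheel with $2n$ univalent vertices, $b_{2n}$ is the coefficient of $x^{2n}$ in $\frac12\ln\frac{\sinh(x/2)}{x/2}$, $\exp_\sqcup$ is the exponential for disjoint union, and $\chi$ averages over all ways of attaching univalent vertices to the circle and then recursively applies the STU relation (a trivalent vertex adjacent to the circle is the difference of the two ways of attaching its two other legs directly to the circle) to obtain chord diagrams. Framings are integers; $0^0=1$. *)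

theory Defs
  imports
    "HOL-Computational_Algebra.Computational_Algebra"
    "HOL-Combinatorics.Multiset_Permutations"
    "HOL-Library.Poly_Mapping"
    "HOL-Library.Function_Algebras"
begin

section \<open>Linear algebra over the rationals\<close>

text \<open>
  Two kinds of linear combinations occur. Where the basis has finitely many elements in each
  degree, a degree-completed space is simply a space of functions \<open>'a \<Rightarrow> rat\<close> (with the pointwise
  operations). Where the basis consists of labelled objects, an element is a sequence whose
  \<open>n\<close>-th entry is its degree \<open>n\<close> part, a finitely supported function.
\<close>

interpretation rat_fun: vector_space "\<lambda>(c::rat) (f::'a \<Rightarrow> rat) x. c * f x"
  by unfold_locales (auto simp: fun_eq_iff algebra_simps)

definition basis :: "'a \<Rightarrow> 'a \<Rightarrow> rat" where
  "basis x = (\<lambda>y. if y = x then 1 else 0)"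

definition hom_part :: "('a \<Rightarrow> nat) \<Rightarrow> nat \<Rightarrow> ('a \<Rightarrow> rat) \<Rightarrow> 'a \<Rightarrow> rat" where
  "hom_part deg n f = (\<lambda>x. if deg x = n then f x else 0)"

type_synonym 'a series = "nat \<Rightarrow> ('a \<Rightarrow>\<^sub>0 rat)"

definition lin_ext :: "('a \<Rightarrow> 'b \<Rightarrow>\<^sub>0 rat) \<Rightarrow> ('a \<Rightarrow>\<^sub>0 rat) \<Rightarrow> 'b \<Rightarrow>\<^sub>0 rat" where
  "lin_ext F p = (\<Sum>x\<in>Poly_Mapping.keys p.
     Poly_Mapping.map (\<lambda>c. Poly_Mapping.lookup p x * c) (F x))"

definition series_prod :: "('a \<Rightarrow> 'b \<Rightarrow> 'c) \<Rightarrow> 'a series \<Rightarrow> 'b series \<Rightarrow> 'c series" where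
  "series_prod f a b = (\<lambda>n. \<Sum>k\<le>n.
     lin_ext (\<lambda>x. lin_ext (\<lambda>y. Poly_Mapping.single (f x y) 1) (b (n - k))) (a k))"

definition series_unit :: "'a \<Rightarrow> 'a series" where
  "series_unit x = (\<lambda>n. if n = 0 then Poly_Mapping.single x 1 else 0)"


section \<open>Noncommutative power series and Drinfeld associators\<close>

text \<open>A noncommutative formal power series is given by its coefficient function on words.\<close>

type_synonym 'g ncseries = "'g list \<Rightarrow> rat"

definition nc_one :: "'g ncseries" where
  "nc_one = basis []"

definition nc_mult :: "'g ncseries \<Rightarrow> 'g ncseries \<Rightarrow> 'g ncseries" (infixl \<open>\<star>\<close> 70) where
  "f \<star> g = (\<lambda>w. \<Sum>k\<le>length w. f (take k w) * g (drop k w))"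

primrec nc_pow :: "'g ncseries \<Rightarrow> nat \<Rightarrow> 'g ncseries" where
  "nc_pow f 0 = nc_one"
| "nc_pow f (Suc k) = f \<star> nc_pow f k"

text \<open>
  The sums below are over all \<open>k\<close> in disguise: \<open>nc_exp\<close> is used for series without constant term
  and \<open>nc_inv\<close> for series with constant term 1, so the terms with \<open>k > length w\<close> vanish.
\<close>

definition nc_exp :: "'g ncseries \<Rightarrow> 'g ncseries" where
  "nc_exp f = (\<lambda>w. \<Sum>k\<le>length w. nc_pow f k w / fact k)"

definition nc_inv :: "'g ncseries \<Rightarrow> 'g ncseries" where
  "nc_inv f = (\<lambda>w. \<Sum>k\<le>length w. nc_pow (nc_one - f) k w)"

definition nc_linear :: "('g \<Rightarrow> rat) \<Rightarrow> 'g ncseries" where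
  "nc_linear x = (\<lambda>w. if length w = 1 then x (hd w) else 0)"

text \<open>\<open>nc_subst f x\<close> is \<open>f\<close> with the linear form \<open>x a\<close> substituted for each letter \<open>a\<close>.\<close>

definition nc_subst :: "'a::finite ncseries \<Rightarrow> ('a \<Rightarrow> 'g \<Rightarrow> rat) \<Rightarrow> 'g ncseries" where
  "nc_subst f x =
     (\<lambda>w. \<Sum>u | length u = length w. f u * (\<Prod>k<length w. x (u ! k) (w ! k)))"

inductive_set lie_polynomials :: "'g ncseries set" where
  gen: "basis [a] \<in> lie_polynomials"
| add: "f \<in> lie_polynomials \<Longrightarrow> g \<in> lie_polynomials \<Longrightarrow> f + g \<in> lie_polynomials"
| scale: "f \<in> lie_polynomials \<Longrightarrow> (\<lambda>w. c * f w) \<in> lie_polynomials"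
| bracket: "f \<in> lie_polynomials \<Longrightarrow> g \<in> lie_polynomials \<Longrightarrow> f \<star> g - g \<star> f \<in> lie_polynomials"

definition lie_series :: "'g ncseries \<Rightarrow> bool" where
  "lie_series f \<longleftrightarrow> (\<forall>n. hom_part length n f \<in> lie_polynomials)"

text \<open>
  The algebra of infinitesimal braids on the strands \<open>0, \<dots>, n - 1\<close>: the generator \<open>t\<^sub>i\<^sub>j = t\<^sub>j\<^sub>i\<close> is the
  letter \<open>(min i j, max i j)\<close>. A word lists horizontal chords in the order in which they are met
  along upward strands.
\<close>

definition tgen :: "nat \<Rightarrow> nat \<Rightarrow> nat \<times> nat" where
  "tgen i j = (min i j, max i j)"

definition tgens :: "nat \<Rightarrow> (nat \<times> nat) set" where
  "tgens n = {(i, j). i < j \<and> j < n}"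

definition braid_relators :: "nat \<Rightarrow> (nat \<times> nat) ncseries set" where
  "braid_relators n =
     {basis (u @ [tgen i j, tgen k l] @ v) - basis (u @ [tgen k l, tgen i j] @ v) | u v i j k l.
        set u \<subseteq> tgens n \<and> set v \<subseteq> tgens n \<and> {i, j, k, l} \<subseteq> {..<n} \<and> distinct [i, j, k, l]}
   \<union> {basis (u @ [tgen i j, tgen i k] @ v) - basis (u @ [tgen i k, tgen i j] @ v)
      + basis (u @ [tgen i j, tgen j k] @ v) - basis (u @ [tgen j k, tgen i j] @ v) | u v i j k.
        set u \<subseteq> tgens n \<and> set v \<subseteq> tgens n \<and> {i, j, k} \<subseteq> {..<n} \<and> distinct [i, j, k]}"

definition braid_eq :: "nat \<Rightarrow> (nat \<times> nat) ncseries \<Rightarrow> (nat \<times> nat) ncseries \<Rightarrow> bool" where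
  "braid_eq n f g \<longleftrightarrow> (\<forall>d. hom_part length d (f - g) \<in> rat_fun.span (braid_relators n))"

text \<open>For disjoint sets of strands, \<open>t_sum P Q\<close> is the linear form \<open>\<Sum>t\<^sub>i\<^sub>j\<close> over \<open>i \<in> P\<close>, \<open>j \<in> Q\<close>.\<close>

definition t_sum :: "nat set \<Rightarrow> nat set \<Rightarrow> nat \<times> nat \<Rightarrow> rat" where
  "t_sum P Q = (\<lambda>(i, j). if i < j \<and> (i \<in> P \<and> j \<in> Q \<or> i \<in> Q \<and> j \<in> P) then 1 else 0)"

text \<open>
  A series in two letters \<open>A\<close> (\<open>False\<close>) and \<open>B\<close> (\<open>True\<close>), placed on three bundles of strands:
  \<open>A\<close> becomes \<open>t\<^sub>P\<^sub>Q\<close> and \<open>B\<close> becomes \<open>t\<^sub>Q\<^sub>R\<close>.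
\<close>

definition on_bundles ::
    "bool ncseries \<Rightarrow> nat set \<Rightarrow> nat set \<Rightarrow> nat set \<Rightarrow> (nat \<times> nat) ncseries" where
  "on_bundles \<Phi> P Q R = nc_subst \<Phi> (\<lambda>b. if b then t_sum Q R else t_sum P Q)"

definition braiding :: "nat set \<Rightarrow> nat set \<Rightarrow> (nat \<times> nat) ncseries" where
  "braiding P Q = nc_exp (nc_linear (\<lambda>g. t_sum P Q g / 2))"

text \<open>
  The pentagon and the two hexagons. Products are read upwards along the strands; with the
  opposite reading (composition of operators) these are Drinfeld's equations
  \<open>\<Phi>\<^sup>1\<^sup>,\<^sup>2\<^sup>,\<^sup>3\<^sup>4 \<Phi>\<^sup>1\<^sup>2\<^sup>,\<^sup>3\<^sup>,\<^sup>4 = \<Phi>\<^sup>2\<^sup>,\<^sup>3\<^sup>,\<^sup>4 \<Phi>\<^sup>1\<^sup>,\<^sup>2\<^sup>3\<^sup>,\<^sup>4 \<Phi>\<^sup>1\<^sup>,\<^sup>2\<^sup>,\<^sup>3\<close>, etc., with \<open>R = exp (t / 2)\<close>.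
  Here \<open>\<Phi>\<close> goes from \<open>(12)3\<close> to \<open>1(23)\<close>.
\<close>

definition drinfeld_associator :: "bool ncseries \<Rightarrow> bool" where
  "drinfeld_associator \<Phi> \<longleftrightarrow>
     (\<exists>\<phi>. lie_series \<phi> \<and> (\<forall>a. \<phi> [a] = 0) \<and> \<Phi> = nc_exp \<phi>) \<and>
     braid_eq 4
       (on_bundles \<Phi> {0} {1} {2} \<star> on_bundles \<Phi> {0} {1, 2} {3} \<star> on_bundles \<Phi> {1} {2} {3})
       (on_bundles \<Phi> {0, 1} {2} {3} \<star> on_bundles \<Phi> {0} {1} {2, 3}) \<and>
     braid_eq 3
       (braiding {0, 1} {2})
       (on_bundles \<Phi> {0} {1} {2} \<star> braiding {1} {2} \<star> nc_inv (on_bundles \<Phi> {0} {2} {1})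
          \<star> braiding {0} {2} \<star> on_bundles \<Phi> {2} {0} {1}) \<and>
     braid_eq 3
       (braiding {0} {1, 2})
       (nc_inv (on_bundles \<Phi> {0} {1} {2}) \<star> braiding {0} {1} \<star> on_bundles \<Phi> {1} {0} {2}
          \<star> braiding {0} {2} \<star> nc_inv (on_bundles \<Phi> {1} {2} {0}))"


section \<open>Chord diagrams on circles and the space \<open>\<A>(m)\<close>\<close>

text \<open>
  Reading the chord endpoints along each of the \<open>m\<close> oriented circles from some base point
  represents a chord diagram by a list of \<open>m\<close> words in which every chord label occurs exactly
  twice. Changing base points rotates words, so a chord diagram is a class of such lists modulo
  rotations and relabelling.
\<close>

definition chord_words :: "nat \<Rightarrow> nat list list set" where
  "chord_words m =
     {ws. length ws = m \<and> (\<forall>x\<in>set (concat ws). count_list (concat ws) x = 2)}"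

definition diagram_iso :: "nat \<Rightarrow> (nat list list \<times> nat list list) set" where
  "diagram_iso m = {(ws, ws'). ws \<in> chord_words m \<and> ws' \<in> chord_words m \<and>
     (\<exists>f. inj_on f (set (concat ws)) \<and>
          (\<forall>i<m. \<exists>k. ws' ! i = rotate k (map f (ws ! i))))}"

type_synonym chord_diagram = "nat list list set"

definition chord_diagrams :: "nat \<Rightarrow> chord_diagram set" where
  "chord_diagrams m = chord_words m // diagram_iso m"

definition diagram_of :: "nat \<Rightarrow> nat list list \<Rightarrow> chord_diagram" where
  "diagram_of m ws = diagram_iso m `` {ws}"

definition diagram_degree :: "chord_diagram \<Rightarrow> nat" where
  "diagram_degree D = length (concat (SOME ws. ws \<in> D)) div 2"

text \<open>Circles are numbered from 1.\<close>

definition chords_of_type :: "nat list list \<Rightarrow> nat \<Rightarrow> nat \<Rightarrow> nat set" where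
  "chords_of_type ws i j =
     {x. if i = j then count_list (ws ! (i - 1)) x = 2
         else x \<in> set (ws ! (i - 1)) \<and> x \<in> set (ws ! (j - 1))}"

definition diagrams_of_type :: "nat \<Rightarrow> (nat \<Rightarrow> nat \<Rightarrow> nat) \<Rightarrow> chord_diagram set" where
  "diagrams_of_type m S =
     {D \<in> chord_diagrams m. \<forall>ws\<in>D. \<forall>i\<in>{1..m}. \<forall>j\<in>{1..m}. card (chords_of_type ws i j) = S i j}"

definition replace_letter :: "nat \<Rightarrow> nat list \<Rightarrow> nat list \<Rightarrow> nat list" where
  "replace_letter x u w = concat (map (\<lambda>y. if y = x then u else [y]) w)"

text \<open>
  The part common to the four diagrams of a 4T relation is a list of words in which three letters
  \<open>p, q, r\<close> (marking the three arcs) occur once and all other letters twice. In the first two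
  terms, \<open>q\<close> and \<open>r\<close> on their own arcs serve as ends of the chords \<open>t\<^sub>p\<^sub>q\<close> and \<open>t\<^sub>p\<^sub>r\<close>, whose other
  ends replace \<open>p\<close>; in the last two, \<open>p\<close> and \<open>r\<close> serve as ends of \<open>t\<^sub>p\<^sub>q\<close> and \<open>t\<^sub>q\<^sub>r\<close>.
\<close>

definition four_T_templates :: "nat \<Rightarrow> (nat list list \<times> nat \<times> nat \<times> nat) set" where
  "four_T_templates m = {(ws, p, q, r). length ws = m \<and> distinct [p, q, r] \<and>
     (\<forall>x\<in>{p, q, r}. count_list (concat ws) x = 1) \<and>
     (\<forall>x\<in>set (concat ws) - {p, q, r}. count_list (concat ws) x = 2)}"

definition four_T_relators :: "nat \<Rightarrow> (chord_diagram \<Rightarrow> rat) set" where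
  "four_T_relators m = {
       basis (diagram_of m (map (replace_letter p [q, r]) ws))
     - basis (diagram_of m (map (replace_letter p [r, q]) ws))
     + basis (diagram_of m (map (replace_letter q [p, r]) ws))
     - basis (diagram_of m (map (replace_letter q [r, p]) ws)) | ws p q r.
     (ws, p, q, r) \<in> four_T_templates m}"

definition four_T_null :: "nat \<Rightarrow> (chord_diagram \<Rightarrow> rat) set" where
  "four_T_null m = {f. (\<forall>D. D \<notin> chord_diagrams m \<longrightarrow> f D = 0) \<and>
     (\<forall>n. hom_part diagram_degree n f \<in> rat_fun.span (four_T_relators m))}"

text \<open>Elements of \<open>\<A>(m)\<close> are cosets, i.e. sets of representatives.\<close>

definition A_class :: "nat \<Rightarrow> (chord_diagram \<Rightarrow> rat) \<Rightarrow> (chord_diagram \<Rightarrow> rat) set" where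
  "A_class m f = {g. g - f \<in> four_T_null m}"

text \<open>
  \<open>\<Sum>D\<in>\<D>. C[D](a)\<close>, evaluated on any representative; meaningful if \<open>\<D>\<close> is finite and the value
  does not depend on the representative.
\<close>

definition coeff_sum :: "chord_diagram set \<Rightarrow> (chord_diagram \<Rightarrow> rat) set \<Rightarrow> rat" where
  "coeff_sum \<D> a = (THE c. \<forall>f\<in>a. (\<Sum>D\<in>\<D>. f D) = c)"


section \<open>The element \<open>\<nu>\<close> and its square root\<close>

text \<open>
  \<open>\<A>(1)\<close> is identified with the algebra of diagrams on an oriented line (cut the circle open at
  any point), where the product is concatenation. A diagram with trivalent vertices on a line is
  given by its vertices, each a cyclically ordered triple of edge labels, and the word of labels
  of edges ending on the line. STU is applied to the vertices in turn, the first
  edge listed at a vertex being one that ends on the line.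
\<close>

fun stu_resolve :: "(nat \<times> nat \<times> nat) list \<Rightarrow> nat list \<Rightarrow> (nat list \<Rightarrow>\<^sub>0 rat)" where
  "stu_resolve [] w = Poly_Mapping.single w 1"
| "stu_resolve ((a, b, c) # vs) w =
     stu_resolve vs (replace_letter a [b, c] w) - stu_resolve vs (replace_letter a [c, b] w)"

text \<open>
  \<open>wheels 0 [s\<^sub>1, \<dots>, s\<^sub>k]\<close> is the disjoint union of wheels with \<open>s\<^sub>i\<close> legs; legs have even labels and
  rim edges odd labels.
\<close>

definition wheel :: "nat \<Rightarrow> nat \<Rightarrow> (nat \<times> nat \<times> nat) list" where
  "wheel offset s =
     map (\<lambda>k. (2 * (offset + k), 2 * (offset + k) + 1, 2 * (offset + Suc k mod s) + 1)) [0..<s]"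

fun wheels :: "nat \<Rightarrow> nat list \<Rightarrow> (nat \<times> nat \<times> nat) list" where
  "wheels offset [] = []"
| "wheels offset (s # ss) = wheel offset s @ wheels (offset + s) ss"

definition chi :: "(nat \<times> nat \<times> nat) list \<Rightarrow> (nat list \<Rightarrow>\<^sub>0 rat)" where
  "chi vs = (let orders = permutations_of_set (fst ` set vs) in
     Poly_Mapping.map (\<lambda>c. c / of_nat (card orders)) (\<Sum>w\<in>orders. stu_resolve vs w))"

definition wheel_coeff :: "nat \<Rightarrow> rat" where
  "wheel_coeff n = fps_nth (fps_const (1/2) *
     (fps_ln 1 oo ((fps_exp (1/2) - fps_exp (- 1/2)) / fps_X - 1))) n"

text \<open>
  A product \<open>W\<^sub>2\<^sub>n\<^sub>1 \<dots> W\<^sub>2\<^sub>n\<^sub>k\<close> has degree \<open>2 (n\<^sub>1 + \<dots> + n\<^sub>k)\<close>, half its number of vertices; the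
  sum over the tuples of a given degree is the corresponding part of the exponential.
\<close>

definition nu :: "nat list series" where
  "nu d = (\<Sum>ns | (\<forall>n\<in>set ns. 1 \<le> n) \<and> 2 * sum_list ns = d.
     Poly_Mapping.map (\<lambda>c. (\<Prod>n\<leftarrow>ns. wheel_coeff (2 * n)) / fact (length ns) * c)
       (chi (wheels 0 (map (\<lambda>n. 2 * n) ns))))"

definition word_concat :: "nat list \<Rightarrow> nat list \<Rightarrow> nat list" where
  "word_concat v w = map (\<lambda>x. 2 * x) v @ map (\<lambda>x. 2 * x + 1) w"

primrec word_pow :: "nat list series \<Rightarrow> nat \<Rightarrow> nat list series" where
  "word_pow a 0 = series_unit []"
| "word_pow a (Suc k) = series_prod word_concat a (word_pow a k)"

text \<open>The square root with constant term 1, as the binomial series \<open>(1 + (\<nu> - 1))\<^sup>1\<^sup>/\<^sup>2\<close>.\<close>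

definition sqrt_nu :: "nat list series" where
  "sqrt_nu n = (\<Sum>k\<le>n. Poly_Mapping.map (\<lambda>c. ((1/2) gchoose k) * c)
     (word_pow (\<lambda>d. nu d - series_unit [] d) k n))"


section \<open>Framed q-tangles\<close>

text \<open>
  A strand at a boundary point is oriented upwards (\<open>True\<close>) or downwards, and carries the number
  of the component to which it belongs. Boundaries are parenthesized words of strands.
\<close>

type_synonym strand = "bool \<times> nat"

datatype qword = Empty | Point strand | Pair qword qword

fun qpair :: "qword \<Rightarrow> qword \<Rightarrow> qword" where
  "qpair Empty v = v"
| "qpair u Empty = u"
| "qpair u v = Pair u v"

fun points :: "qword \<Rightarrow> strand list" where
  "points Empty = []"
| "points (Point s) = [s]"
| "points (Pair u v) = points u @ points v"

text \<open>
  \<open>Cross \<epsilon> s t\<close> is the crossing whose strands are \<open>s\<close> (from bottom left to top right if upward)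
  and \<open>t\<close> (from bottom right to top left if upward), obtained from \<open>X\<^sub>+\<close> (\<open>\<epsilon> = True\<close>) or \<open>X\<^sub>-\<close> by
  reversing the downward strands. In \<open>Cap s\<close> and \<open>Cup s\<close>, \<open>s\<close> is the strand at the left end.
  \<open>Assoc u v w\<close> goes from \<open>(uv)w\<close> to \<open>u(vw)\<close>. In \<open>Comp A B\<close>, \<open>B\<close> is placed on top of \<open>A\<close>.
\<close>

datatype qtangle =
    Trivial strand
  | Cross bool strand strand
  | Cap strand
  | Cup strand
  | Assoc qword qword qword
  | AssocInv qword qword qword
  | Comp qtangle qtangle
  | Juxt qtangle qtangle

definition reversed :: "strand \<Rightarrow> strand" where
  "reversed s = (\<not> fst s, snd s)"

fun bottom_word :: "qtangle \<Rightarrow> qword" and top_word :: "qtangle \<Rightarrow> qword" where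
  "bottom_word (Trivial s) = Point s"
| "top_word (Trivial s) = Point s"
| "bottom_word (Cross e s t) = Pair (Point s) (Point t)"
| "top_word (Cross e s t) = Pair (Point t) (Point s)"
| "bottom_word (Cap s) = Pair (Point s) (Point (reversed s))"
| "top_word (Cap s) = Empty"
| "bottom_word (Cup s) = Empty"
| "top_word (Cup s) = Pair (Point s) (Point (reversed s))"
| "bottom_word (Assoc u v w) = qpair (qpair u v) w"
| "top_word (Assoc u v w) = qpair u (qpair v w)"
| "bottom_word (AssocInv u v w) = qpair u (qpair v w)"
| "top_word (AssocInv u v w) = qpair (qpair u v) w"
| "bottom_word (Comp A B) = bottom_word A"
| "top_word (Comp A B) = top_word B"
| "bottom_word (Juxt A B) = qpair (bottom_word A) (bottom_word B)"
| "top_word (Juxt A B) = qpair (top_word A) (top_word B)"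

fun composable :: "qtangle \<Rightarrow> bool" where
  "composable (Comp A B) \<longleftrightarrow> composable A \<and> composable B \<and> top_word A = bottom_word B"
| "composable (Juxt A B) \<longleftrightarrow> composable A \<and> composable B"
| "composable _ \<longleftrightarrow> True"


section \<open>Chord diagrams on tangles\<close>

text \<open>
  An oriented 1-manifold with boundary points on a bottom and a top line (and, during gluing, on a
  middle line), with chord endpoints on it: arcs, and circles given by component number and word.
  Words list chord endpoints along the orientation.
\<close>

datatype port = Bot nat | Mid nat | Top nat

datatype arc = Arc (arc_source: port) (arc_target: port) (arc_comp: nat) (arc_word: "nat list")

type_synonym tangle_diagram = "arc list \<times> (nat \<times> nat list) list"

definition glue :: "nat \<Rightarrow> tangle_diagram \<Rightarrow> tangle_diagram" where
  "glue i D = (case D of (as, cs) \<Rightarrow>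
     (case (find (\<lambda>a. arc_target a = Mid i) as, find (\<lambda>a. arc_source a = Mid i) as) of
        (Some a, Some b) \<Rightarrow>
          if a = b then (remove1 a as, cs @ [(arc_comp a, arc_word a)])
          else (Arc (arc_source a) (arc_target b) (arc_comp a) (arc_word a @ arc_word b)
                  # remove1 a (remove1 b as), cs)
      | _ \<Rightarrow> (as, cs)))"

definition map_diagram ::
    "(port \<Rightarrow> port) \<Rightarrow> (nat \<Rightarrow> nat) \<Rightarrow> tangle_diagram \<Rightarrow> tangle_diagram" where
  "map_diagram \<pi> f D =
     (map (\<lambda>a. Arc (\<pi> (arc_source a)) (\<pi> (arc_target a)) (arc_comp a) (map f (arc_word a))) (fst D),
      map (\<lambda>(c, w). (c, map f w)) (snd D))"

fun top_to_mid :: "port \<Rightarrow> port" where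
  "top_to_mid (Top i) = Mid i"
| "top_to_mid x = x"

fun bot_to_mid :: "port \<Rightarrow> port" where
  "bot_to_mid (Bot i) = Mid i"
| "bot_to_mid x = x"

fun shift_port :: "nat \<Rightarrow> nat \<Rightarrow> port \<Rightarrow> port" where
  "shift_port b t (Bot i) = Bot (b + i)"
| "shift_port b t (Top i) = Top (t + i)"
| "shift_port b t (Mid i) = Mid i"

definition disjoint_union :: "tangle_diagram \<Rightarrow> tangle_diagram \<Rightarrow> tangle_diagram" where
  "disjoint_union D E =
     (let D' = map_diagram id (\<lambda>x. 2 * x) D; E' = map_diagram id (\<lambda>x. 2 * x + 1) E
      in (fst D' @ fst E', snd D' @ snd E'))"

text \<open>\<open>stack n D E\<close> glues the \<open>n\<close> top points of \<open>D\<close> to the \<open>n\<close> bottom points of \<open>E\<close>.\<close>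

definition stack :: "nat \<Rightarrow> tangle_diagram \<Rightarrow> tangle_diagram \<Rightarrow> tangle_diagram" where
  "stack n D E =
     fold glue [0..<n] (disjoint_union (map_diagram top_to_mid id D) (map_diagram bot_to_mid id E))"

text \<open>\<open>b\<close> and \<open>t\<close> are the numbers of bottom and top points of \<open>D\<close>.\<close>

definition beside :: "nat \<Rightarrow> nat \<Rightarrow> tangle_diagram \<Rightarrow> tangle_diagram \<Rightarrow> tangle_diagram" where
  "beside b t D E = disjoint_union D (map_diagram (shift_port b t) id E)"

text \<open>
  An arc between \<open>x\<close> and \<open>y\<close>, running from \<open>x\<close> to \<open>y\<close> or the other way round; \<open>w\<close> is read from
  \<open>x\<close> to \<open>y\<close> in both cases.
\<close>

definition oriented_arc :: "bool \<Rightarrow> port \<Rightarrow> port \<Rightarrow> nat \<Rightarrow> nat list \<Rightarrow> arc" where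
  "oriented_arc fwd x y c w = (if fwd then Arc x y c w else Arc y x c (rev w))"

definition reversal_sign :: "bool \<Rightarrow> nat list \<Rightarrow> rat" where
  "reversal_sign fwd w = (if fwd then 1 else (- 1) ^ length w)"

definition trivial_diagram :: "strand list \<Rightarrow> nat list list \<Rightarrow> tangle_diagram" where
  "trivial_diagram ss ws =
     (map (\<lambda>j. oriented_arc (fst (ss ! j)) (Bot j) (Top j) (snd (ss ! j)) (ws ! j))
        [0..<length ss], [])"

definition cross_diagram :: "strand \<Rightarrow> strand \<Rightarrow> nat list \<Rightarrow> nat list \<Rightarrow> tangle_diagram" where
  "cross_diagram s t v w =
     ([oriented_arc (fst s) (Bot 0) (Top 1) (snd s) v,
       oriented_arc (fst t) (Bot 1) (Top 0) (snd t) w], [])"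

definition cap_diagram :: "strand \<Rightarrow> nat list \<Rightarrow> tangle_diagram" where
  "cap_diagram s w = ([oriented_arc (fst s) (Bot 0) (Bot 1) (snd s) w], [])"

definition cup_diagram :: "strand \<Rightarrow> nat list \<Rightarrow> tangle_diagram" where
  "cup_diagram s w = ([oriented_arc (\<not> fst s) (Top 0) (Top 1) (snd s) w], [])"

fun skeleton :: "qtangle \<Rightarrow> tangle_diagram" where
  "skeleton (Trivial s) = trivial_diagram [s] [[]]"
| "skeleton (Cross e s t) = cross_diagram s t [] []"
| "skeleton (Cap s) = cap_diagram s []"
| "skeleton (Cup s) = cup_diagram s []"
| "skeleton (Assoc u v w) =
     (let ss = points u @ points v @ points w in trivial_diagram ss (map (\<lambda>_. []) ss))"
| "skeleton (AssocInv u v w) =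
     (let ss = points u @ points v @ points w in trivial_diagram ss (map (\<lambda>_. []) ss))"
| "skeleton (Comp A B) = stack (length (points (top_word A))) (skeleton A) (skeleton B)"
| "skeleton (Juxt A B) =
     beside (length (points (bottom_word A))) (length (points (top_word A))) (skeleton A) (skeleton B)"


section \<open>The framed Kontsevich integral\<close>

text \<open>Value on the crossing: \<open>k\<close> parallel chords with coefficient \<open>(\<plusminus>1)\<^sup>k / (2\<^sup>k k!)\<close>.\<close>

definition Z_cross :: "bool \<Rightarrow> strand \<Rightarrow> strand \<Rightarrow> tangle_diagram series" where
  "Z_cross e s t = (\<lambda>k. Poly_Mapping.single (cross_diagram s t [0..<k] [0..<k])
     ((if e then 1 else - 1) ^ k / (2 ^ k * fact k)
        * reversal_sign (fst s) [0..<k] * reversal_sign (fst t) [0..<k]))"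

text \<open>
  The diagram of a word \<open>h\<close> of horizontal chords on trivial strands: its \<open>k\<close>-th chord from the
  bottom, labelled \<open>k\<close>, joins the two strands in \<open>h ! k\<close>.
\<close>

definition strand_word :: "(nat \<times> nat) list \<Rightarrow> nat \<Rightarrow> nat list" where
  "strand_word h j = filter (\<lambda>k. j = fst (h ! k) \<or> j = snd (h ! k)) [0..<length h]"

definition Z_horizontal :: "strand list \<Rightarrow> (nat \<times> nat) ncseries \<Rightarrow> tangle_diagram series" where
  "Z_horizontal ss f = (\<lambda>n.
     \<Sum>h | length h = n \<and> set h \<subseteq> tgens (length ss).
       Poly_Mapping.single (trivial_diagram ss (map (strand_word h) [0..<length ss]))
         (f h * (\<Prod>j<length ss. reversal_sign (fst (ss ! j)) (strand_word h j))))"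

definition Z_assoc :: "bool ncseries \<Rightarrow> qword \<Rightarrow> qword \<Rightarrow> qword \<Rightarrow> tangle_diagram series" where
  "Z_assoc \<Phi> u v w =
     (let p = length (points u); q = length (points v); r = length (points w)
      in Z_horizontal (points u @ points v @ points w)
           (on_bundles \<Phi> {..<p} {p..<p + q} {p + q..<p + q + r}))"

fun Z :: "bool ncseries \<Rightarrow> qtangle \<Rightarrow> tangle_diagram series" where
  "Z \<Phi> (Trivial s) = series_unit (trivial_diagram [s] [[]])"
| "Z \<Phi> (Cross e s t) = Z_cross e s t"
| "Z \<Phi> (Cap s) = (\<lambda>n. lin_ext
     (\<lambda>w. Poly_Mapping.single (cap_diagram s w) (reversal_sign (fst s) w)) (sqrt_nu n))"
| "Z \<Phi> (Cup s) = (\<lambda>n. lin_ext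
     (\<lambda>w. Poly_Mapping.single (cup_diagram s w) (reversal_sign (\<not> fst s) w)) (sqrt_nu n))"
| "Z \<Phi> (Assoc u v w) = Z_assoc \<Phi> u v w"
| "Z \<Phi> (AssocInv u v w) = Z_assoc (nc_inv \<Phi>) u v w"
| "Z \<Phi> (Comp A B) = series_prod (stack (length (points (top_word A)))) (Z \<Phi> A) (Z \<Phi> B)"
| "Z \<Phi> (Juxt A B) =
     series_prod (beside (length (points (bottom_word A))) (length (points (top_word A)))) (Z \<Phi> A) (Z \<Phi> B)"


section \<open>Framed links\<close>

text \<open>
  Framed oriented links in the 3-sphere with components numbered \<open>1, \<dots>, m\<close> are presented by closed
  q-tangles, with the blackboard framing.
\<close>

definition framed_link :: "nat \<Rightarrow> qtangle \<Rightarrow> bool" where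
  "framed_link m L \<longleftrightarrow> composable L \<and> bottom_word L = Empty \<and> top_word L = Empty \<and>
     distinct (map fst (snd (skeleton L))) \<and> set (map fst (snd (skeleton L))) = {1..m}"

definition closed_diagram :: "nat \<Rightarrow> tangle_diagram \<Rightarrow> chord_diagram" where
  "closed_diagram m D = diagram_of m (map (\<lambda>i. the (map_of (snd D) i)) [1..<Suc m])"

definition Z_link_rep :: "bool ncseries \<Rightarrow> nat \<Rightarrow> qtangle \<Rightarrow> chord_diagram \<Rightarrow> rat" where
  "Z_link_rep \<Phi> m L D = (let z = Z \<Phi> L (diagram_degree D) in
     (\<Sum>E | E \<in> Poly_Mapping.keys z \<and> closed_diagram m E = D. Poly_Mapping.lookup z E))"

definition Z_link :: "bool ncseries \<Rightarrow> nat \<Rightarrow> qtangle \<Rightarrow> (chord_diagram \<Rightarrow> rat) set" where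
  "Z_link \<Phi> m L = A_class m (Z_link_rep \<Phi> m L)"

text \<open>The crossings of a diagram, with sign and the components of the two strands.\<close>

fun crossings :: "qtangle \<Rightarrow> (int \<times> nat \<times> nat) list" where
  "crossings (Cross e s t) =
     [((if e then 1 else - 1) * (if fst s = fst t then 1 else - 1), snd s, snd t)]"
| "crossings (Comp A B) = crossings A @ crossings B"
| "crossings (Juxt A B) = crossings A @ crossings B"
| "crossings _ = []"

definition linking_number :: "qtangle \<Rightarrow> nat \<Rightarrow> nat \<Rightarrow> rat" where
  "linking_number L i j =
     of_int (\<Sum>(e, c, d)\<leftarrow>crossings L. if (c, d) = (i, j) \<or> (c, d) = (j, i) then e else 0) / 2"

text \<open>The blackboard framing of a component is its writhe.\<close>

definition framing :: "qtangle \<Rightarrow> nat \<Rightarrow> int" where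
  "framing L i = (\<Sum>(e, c, d)\<leftarrow>crossings L. if c = i \<and> d = i then e else 0)"

definition ell :: "qtangle \<Rightarrow> nat \<Rightarrow> nat \<Rightarrow> rat" where
  "ell L i j = (if i = j then of_int (framing L i) / 2 else linking_number L i j)"

definition ell_matrix :: "nat \<Rightarrow> (nat \<Rightarrow> nat \<Rightarrow> nat) \<Rightarrow> qtangle \<Rightarrow> rat" where
  "ell_matrix m S L =
     (\<Prod>(i, j) | 1 \<le> i \<and> i \<le> j \<and> j \<le> m. 1 / fact (S i j) * ell L i j ^ S i j)"

end

(*
  Counting chords by type turns Z into a multiplicative invariant with values in a commutative
  ring: the monoid algebra over multisets of types {#i, j#}. A commutative image cannot see
  associators, which are exponentials of Lie series without linear part, and it sends the nonempty
  products of wheels in nu to 0, because every application of STU produces two diagrams with the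
  same chord types. Only the crossings contribute, each a factor exp (+- X_ij / 2), so that the
  image of Z(L) is exp (sum of ell_ij X_ij), and the claim is a comparison of coefficients. The 4T
  relators cancel in pairs of diagrams with equal chord types.
*)

theory Submission
  imports Defs
begin

text \<open>The type of a chord depends only on the components that carry its two ends, and each arc
  of an open tangle already bears the number of its component. Types can therefore be counted before
  anything is closed up, and the count is additive, provided that gluing really joins arcs of equal
  component. This proviso is the main formal burden: \<open>glue\<close> searches a list of arcs and
  does nothing when the search fails, so every diagram occurring in Z must be shown to have the
  ports that its tangle prescribes. Reversing a strand brings a sign for each chord end on it. On
  caps and cups each chord has both ends on the same strand, so these signs vanish; at a crossing
  each chord has one end on either strand, and the signs turn the crossing of upward strands into
  the oriented crossing counted by linking numbers and writhes. The image of Z is compared with an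
  exponential one degree at a time. A monomial in n chord types is read off in degree n, so the ring
  needs no completion. The factors \<open>1 / fact (S i j)\<close> come from the multinomial
  theorem, applied to the n-th power of a linear form divided by n!.\<close>

type_synonym type_ring = "nat multiset multiset \<Rightarrow>\<^sub>0 rat"

section \<open>Linear extension with values in the type ring\<close>

abbreviation scalar :: "rat \<Rightarrow> type_ring" where
  "scalar c \<equiv> Poly_Mapping.single 0 c"

lemma scalar_mult: "scalar (a * b) = scalar a * scalar b"
  by (simp add: mult_single)

lemma scalar_prod: "scalar (prod f A) = (\<Prod>x\<in>A. scalar (f x))"
  by (induction A rule: infinite_finite_induct) (auto simp: scalar_mult simp flip: single_one)

lemma scalar_sum: "scalar (sum f A) = (\<Sum>x\<in>A. scalar (f x))"
  by (induction A rule: infinite_finite_induct) (auto simp: single_add)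

text \<open>Two weights are used: \<open>weight\<close>, which records the chord types of a tangle
  diagram, and the constant 1, which adds up coefficients and suffices for words on a single
  strand.\<close>

definition ev :: "('a \<Rightarrow> type_ring) \<Rightarrow> ('a \<Rightarrow>\<^sub>0 rat) \<Rightarrow> type_ring" where
  "ev w p = (\<Sum>x\<in>Poly_Mapping.keys p. scalar (Poly_Mapping.lookup p x) * w x)"

text \<open>Keys can cancel in a sum, so the evaluations of \<open>p\<close>, \<open>q\<close> and
  \<open>p + q\<close> have to be compared over a common finite set of keys.\<close>

lemma ev_superset:
  assumes "finite A" "Poly_Mapping.keys p \<subseteq> A"
  shows "ev w p = (\<Sum>x\<in>A. scalar (Poly_Mapping.lookup p x) * w x)"
  unfolding ev_def by (rule sum.mono_neutral_left) (use assms in \<open>auto simp: in_keys_iff\<close>)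

lemma ev_0 [simp]: "ev w 0 = 0"
  by (simp add: ev_def)

lemma ev_single [simp]: "ev w (Poly_Mapping.single x c) = scalar c * w x"
  by (simp add: ev_def)

lemma ev_add: "ev w (p + q) = ev w p + ev w q"
proof -
  let ?A = "Poly_Mapping.keys p \<union> Poly_Mapping.keys q"
  have "ev w (p + q) = (\<Sum>x\<in>?A. scalar (Poly_Mapping.lookup (p + q) x) * w x)"
    by (rule ev_superset) (auto simp: Poly_Mapping.keys_add)
  also have "\<dots> = ev w p + ev w q"
    by (simp add: lookup_add single_add algebra_simps sum.distrib ev_superset[of ?A p] ev_superset[of ?A q])
  finally show ?thesis .
qed

lemma ev_sum: "ev w (sum f A) = (\<Sum>x\<in>A. ev w (f x))"
  by (induction A rule: infinite_finite_induct) (auto simp: ev_add)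

lemma keys_diff_subset:
  "Poly_Mapping.keys (p - q :: 'a \<Rightarrow>\<^sub>0 rat) \<subseteq> Poly_Mapping.keys p \<union> Poly_Mapping.keys q"
  by (auto simp: in_keys_iff lookup_minus)

lemma ev_diff: "ev w (p - q) = ev w p - ev w q"
  using ev_add[of w "p - q" q] by simp

lemma lookup_scale:
  "Poly_Mapping.lookup (Poly_Mapping.map (\<lambda>c. f c) p) x = f (Poly_Mapping.lookup p x)"
  if "f 0 = (0::rat)"
  using that by transfer (auto simp: when_def)

lemma ev_scale: "ev w (Poly_Mapping.map (\<lambda>c. k * c) p) = scalar k * ev w p"
proof -
  have "ev w (Poly_Mapping.map (\<lambda>c. k * c) p) =
      (\<Sum>x\<in>Poly_Mapping.keys p. scalar (Poly_Mapping.lookup (Poly_Mapping.map (\<lambda>c. k * c) p) x) * w x)"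
    by (rule ev_superset) (auto simp: in_keys_iff lookup_scale)
  then show ?thesis
    by (simp add: lookup_scale scalar_mult ev_def sum_distrib_left mult.assoc)
qed

lemma ev_scale_divide: "ev w (Poly_Mapping.map (\<lambda>c. c / k) p) = scalar (1 / k) * ev w p"
  using ev_scale[of w "1 / k" p] by simp

lemma ev_lin_ext:
  "ev w (lin_ext F p) = (\<Sum>x\<in>Poly_Mapping.keys p. scalar (Poly_Mapping.lookup p x) * ev w (F x))"
  by (simp add: lin_ext_def ev_sum ev_scale)

text \<open>Multiplicativity is demanded only on the supports, because \<open>stack\<close> adds
  chord types only for diagrams whose ports match, and this is known just for the diagrams that
  occur in Z.\<close>

lemma ev_series_prod:
  assumes "\<And>k x y. k \<le> n \<Longrightarrow> x \<in> Poly_Mapping.keys (a k) \<Longrightarrow> y \<in> Poly_Mapping.keys (b (n - k)) \<Longrightarrow>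
    w (f x y) = u x * v y"
  shows "ev w (series_prod f a b n) = (\<Sum>k\<le>n. ev u (a k) * ev v (b (n - k)))"
  unfolding series_prod_def ev_sum
proof (rule sum.cong [OF refl])
  fix k assume "k \<in> {..n}"
  then have "ev w (lin_ext (\<lambda>x. lin_ext (\<lambda>y. Poly_Mapping.single (f x y) 1) (b (n - k))) (a k)) =
    (\<Sum>x\<in>Poly_Mapping.keys (a k). scalar (Poly_Mapping.lookup (a k) x) *
      (\<Sum>y\<in>Poly_Mapping.keys (b (n - k)). scalar (Poly_Mapping.lookup (b (n - k)) y) * (u x * v y)))"
    by (simp add: ev_lin_ext assms)
  also have "\<dots> = ev u (a k) * ev v (b (n - k))"
    by (simp add: ev_def sum_distrib_left sum_distrib_right ac_simps) (subst sum.swap, rule refl)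
  finally show "ev w (lin_ext (\<lambda>x. lin_ext (\<lambda>y. Poly_Mapping.single (f x y) 1) (b (n - k))) (a k)) =
    ev u (a k) * ev v (b (n - k))" .
qed

lemma keys_sum_subset:
  "Poly_Mapping.keys (sum f A) \<subseteq> (\<Union>x\<in>A. Poly_Mapping.keys (f x :: 'a \<Rightarrow>\<^sub>0 rat))"
  by (induction A rule: infinite_finite_induct) (use Poly_Mapping.keys_add in fastforce)+

lemma keys_scale_subset:
  "f 0 = 0 \<Longrightarrow> Poly_Mapping.keys (Poly_Mapping.map (\<lambda>c. f c) (p :: 'a \<Rightarrow>\<^sub>0 rat) :: _ \<Rightarrow>\<^sub>0 rat) \<subseteq> Poly_Mapping.keys p"
  by (auto simp: in_keys_iff lookup_scale)

lemma keys_lin_ext: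
  "Poly_Mapping.keys (lin_ext F p) \<subseteq> (\<Union>x\<in>Poly_Mapping.keys p. Poly_Mapping.keys (F x))"
proof -
  have "Poly_Mapping.keys (lin_ext F p) \<subseteq>
     (\<Union>x\<in>Poly_Mapping.keys p. Poly_Mapping.keys (Poly_Mapping.map (\<lambda>c. Poly_Mapping.lookup p x * c) (F x)))"
    unfolding lin_ext_def by (rule keys_sum_subset)
  also have "\<dots> \<subseteq> (\<Union>x\<in>Poly_Mapping.keys p. Poly_Mapping.keys (F x))"
    by (intro UN_mono keys_scale_subset) auto
  finally show ?thesis .
qed

lemma keys_series_prodE:
  assumes "z \<in> Poly_Mapping.keys (series_prod f a b n)"
  obtains k x y where "k \<le> n" "x \<in> Poly_Mapping.keys (a k)" "y \<in> Poly_Mapping.keys (b (n - k))" "z = f x y"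
proof -
  from assms obtain k where k: "k \<le> n"
    and "z \<in> Poly_Mapping.keys (lin_ext (\<lambda>x. lin_ext (\<lambda>y. Poly_Mapping.single (f x y) 1) (b (n - k))) (a k))"
    unfolding series_prod_def using keys_sum_subset by fastforce
  then obtain x where x: "x \<in> Poly_Mapping.keys (a k)"
    and "z \<in> Poly_Mapping.keys (lin_ext (\<lambda>y. Poly_Mapping.single (f x y) (1::rat)) (b (n - k)))"
    using keys_lin_ext by fastforce
  then obtain y where "y \<in> Poly_Mapping.keys (b (n - k))" "z \<in> Poly_Mapping.keys (Poly_Mapping.single (f x y) (1::rat))"
    using keys_lin_ext by fastforce
  with k x that show thesis by auto
qed

section \<open>The exponential, degree by degree\<close>

definition Exp :: "type_ring \<Rightarrow> nat \<Rightarrow> type_ring" where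
  "Exp x n = scalar (1 / fact n) * x ^ n"

lemma Exp_0 [simp]: "Exp 0 n = (if n = 0 then 1 else 0)"
  by (simp add: Exp_def power_0_left)

text \<open>This is exp (x + y) = exp x * exp y for commuting x and y, read in degree
  \<open>n\<close>: the binomial theorem divided by n!. It matches the Cauchy product in
  \<open>series_prod\<close>.\<close>

lemma Exp_add: "Exp (x + y) n = (\<Sum>k\<le>n. Exp x k * Exp y (n - k))"
proof -
  have "Exp (x + y) n = (\<Sum>k\<le>n. scalar (1 / fact n) * (of_nat (n choose k) * x ^ k * y ^ (n - k)))"
    by (simp add: Exp_def binomial_ring sum_distrib_left)
  also have "\<dots> = (\<Sum>k\<le>n. Exp x k * Exp y (n - k))"
  proof (rule sum.cong [OF refl])
    fix k assume "k \<in> {..n}"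
    then have "scalar (1 / fact n) * of_nat (n choose k) = scalar (1 / fact k) * scalar (1 / fact (n - k))"
      by (simp add: mult_single binomial_fact flip: single_of_nat)
    then show "scalar (1 / fact n) * (of_nat (n choose k) * x ^ k * y ^ (n - k)) = Exp x k * Exp y (n - k)"
      unfolding Exp_def by (metis (no_types, lifting) mult.assoc mult.left_commute)
  qed
  finally show ?thesis .
qed

section \<open>Abelianization of associators\<close>

definition words :: "nat \<Rightarrow> 'a list set" where
  "words n = {u. length u = n}"

lemma finite_words [simp]: "finite (words n :: 'a::finite list set)"
  using finite_lists_length_eq[of "UNIV :: 'a set" n] by (simp add: words_def)

lemma words_0 [simp]: "words 0 = {[]}"
  by (auto simp: words_def)

text \<open>Degree \<open>n\<close> part of the image of \<open>f\<close> when commuting elements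
  \<open>Y a\<close> are substituted for the letters. The finite alphabet makes the sum over words
  of a given length finite.\<close>

definition cev :: "('a \<Rightarrow> type_ring) \<Rightarrow> 'a::finite ncseries \<Rightarrow> nat \<Rightarrow> type_ring" where
  "cev Y f n = (\<Sum>u\<in>words n. scalar (f u) * prod_list (map Y u))"

text \<open>Cutting a word of length \<open>n\<close> at position \<open>k\<close> is a bijection
  with the pairs of words of lengths \<open>k\<close> and \<open>n - k\<close>.\<close>

lemma cev_mult: "cev Y (f \<star> g) n = (\<Sum>k\<le>n. cev Y f k * cev Y g (n - k))"
proof -
  have "cev Y (f \<star> g) n =
      (\<Sum>u\<in>words n. \<Sum>k\<le>n. scalar (f (take k u) * g (drop k u)) * prod_list (map Y u))"
    unfolding cev_def
    by (rule sum.cong) (auto simp: nc_mult_def words_def scalar_sum sum_distrib_right)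
  also have "\<dots> = (\<Sum>k\<le>n. \<Sum>u\<in>words n. scalar (f (take k u) * g (drop k u)) * prod_list (map Y u))"
    by (rule sum.swap)
  also have "\<dots> = (\<Sum>k\<le>n. cev Y f k * cev Y g (n - k))"
  proof (rule sum.cong [OF refl])
    fix k assume k: "k \<in> {..n}"
    have "cev Y f k * cev Y g (n - k) = (\<Sum>(u, v)\<in>words k \<times> words (n - k).
        (scalar (f u) * prod_list (map Y u)) * (scalar (g v) * prod_list (map Y v)))"
      by (simp add: cev_def sum_product sum.cartesian_product)
    also have "\<dots> = (\<Sum>u\<in>words n. scalar (f (take k u) * g (drop k u)) * prod_list (map Y u))"
      using k
      by (intro sum.reindex_bij_witness[of _ "\<lambda>u. (take k u, drop k u)" "\<lambda>(u, v). u @ v"])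
        (auto simp: words_def scalar_mult mult_ac)
    finally show "(\<Sum>u\<in>words n. scalar (f (take k u) * g (drop k u)) * prod_list (map Y u)) =
      cev Y f k * cev Y g (n - k)" by simp
  qed
  finally show ?thesis .
qed

lemma cev_add: "cev Y (f + g) n = cev Y f n + cev Y g n"
  by (simp add: cev_def single_add algebra_simps sum.distrib)

lemma cev_diff: "cev Y (f - g) n = cev Y f n - cev Y g n"
  by (simp add: cev_def single_diff algebra_simps sum_subtractf)

lemma cev_scale: "cev Y (\<lambda>w. c * f w) n = scalar c * cev Y f n"
  by (simp add: cev_def scalar_mult sum_distrib_left mult.assoc)

lemma cev_one: "cev Y nc_one n = (if n = 0 then 1 else 0)"
proof (cases "n = 0")
  case False
  then show ?thesis
    unfolding cev_def by (auto simp: nc_one_def basis_def words_def intro!: sum.neutral)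
qed (auto simp: cev_def nc_one_def basis_def)

lemma cev_pow_eq_0:
  assumes "\<And>n. cev Y f n = 0"
  shows "cev Y (nc_pow f k) n = (if k = 0 \<and> n = 0 then 1 else 0)"
  by (cases k) (auto simp: cev_one cev_mult assms)

text \<open>Serves both \<open>nc_exp\<close> (\<open>c k = 1 / fact k\<close>) and
  \<open>nc_inv\<close> (\<open>c k = 1\<close>): if the image of \<open>f\<close> is 0 in every
  degree, only the zeroth power survives.\<close>

lemma cev_sum_pow:
  assumes "\<And>n. cev Y f n = 0" and c: "c 0 = 1"
  shows "cev Y (\<lambda>w. \<Sum>k\<le>length w. nc_pow f k w * c k) n = (if n = 0 then 1 else 0)"
proof -
  have "cev Y (\<lambda>w. \<Sum>k\<le>length w. nc_pow f k w * c k) n =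
      (\<Sum>u\<in>words n. \<Sum>k\<le>n. scalar (c k) * (scalar (nc_pow f k u) * prod_list (map Y u)))"
    unfolding cev_def
    by (rule sum.cong) (auto simp: words_def scalar_sum sum_distrib_left sum_distrib_right scalar_mult mult_ac)
  also have "\<dots> = (\<Sum>k\<le>n. scalar (c k) * cev Y (nc_pow f k) n)"
    by (subst sum.swap) (simp add: cev_def sum_distrib_left)
  also have "\<dots> = (if n = 0 then 1 else 0)"
    by (simp add: cev_pow_eq_0[OF assms(1)] c)
  finally show ?thesis .
qed

text \<open>Brackets cancel in every degree since the target is commutative, and the generators are
  supported on words of length 1, the one degree left open here.\<close>

lemma cev_lie_polynomial:
  assumes "f \<in> lie_polynomials" "n \<noteq> 1"
  shows "cev Y f n = 0"
  using assms
proof (induction arbitrary: n)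
  case (gen a)
  then show ?case
    unfolding cev_def by (intro sum.neutral) (auto simp: basis_def words_def)
next
  case (bracket f g)
  have "(\<Sum>k\<le>n. cev Y f k * cev Y g (n - k)) = (\<Sum>k\<le>n. cev Y g k * cev Y f (n - k))"
    by (rule sum.reindex_bij_witness[of _ "\<lambda>k. n - k" "\<lambda>k. n - k"]) (auto simp: mult.commute)
  then show ?case
    by (simp only: cev_diff cev_mult diff_self)
qed (simp_all add: cev_add cev_scale)

lemma cev_hom_part: "cev Y (hom_part length n f) n = cev Y f n"
  unfolding cev_def by (rule sum.cong) (auto simp: hom_part_def words_def)

text \<open>The remaining degree 1 only involves the coefficients \<open>f [a]\<close>, which vanish
  by assumption.\<close>

lemma cev_lie_series:
  assumes "lie_series f" "\<forall>a. f [a] = 0"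
  shows "cev Y f n = 0"
proof (cases "n = 1")
  case True
  then show ?thesis
    using assms(2) unfolding cev_def by (intro sum.neutral) (auto simp: words_def length_Suc_conv)
next
  case False
  then have "cev Y (hom_part length n f) n = 0"
    using assms(1) by (intro cev_lie_polynomial) (auto simp: lie_series_def)
  then show ?thesis by (simp add: cev_hom_part)
qed

lemma cev_associator:
  assumes "drinfeld_associator \<Phi>"
  shows "cev Y \<Phi> n = (if n = 0 then 1 else 0)" "cev Y (nc_inv \<Phi>) n = (if n = 0 then 1 else 0)"
proof -
  obtain \<phi> where \<phi>: "lie_series \<phi>" "\<forall>a. \<phi> [a] = 0" "\<Phi> = nc_exp \<phi>"
    using assms by (auto simp: drinfeld_associator_def)
  have *: "cev Y \<Phi> n = (if n = 0 then 1 else 0)" for n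
    using cev_sum_pow[OF cev_lie_series[OF \<phi>(1,2)], of "\<lambda>k. 1 / fact k" Y n]
    by (simp add: \<phi>(3) nc_exp_def)
  \<comment> \<open>In degree 0 the two values 1 cancel. So \<open>nc_inv\<close>, the geometric
    series in \<open>nc_one - \<Phi>\<close>, keeps only its zeroth term.\<close>
  have "cev Y (nc_one - \<Phi>) n = 0" for n
    by (simp add: cev_diff cev_one *)
  from cev_sum_pow[OF this, of "\<lambda>_. 1" n] show "cev Y (nc_inv \<Phi>) n = (if n = 0 then 1 else 0)"
    by (simp add: nc_inv_def)
  show "cev Y \<Phi> n = (if n = 0 then 1 else 0)" by (fact *)
qed

text \<open>Distributivity: a product of \<open>n\<close> sums over \<open>G\<close> expands into a
  sum over the words of length \<open>n\<close>. The factor \<open>F\<close> depends on the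
  position, both because the induction removes the first letter and shifts, and because it will
  depend on the \<open>k\<close>-th letter of another word.\<close>

lemma sum_lists_prod:
  fixes F :: "nat \<Rightarrow> 'a \<Rightarrow> 'b::comm_semiring_1"
  assumes "finite G"
  shows "(\<Sum>h | length h = n \<and> set h \<subseteq> G. \<Prod>k<n. F k (h ! k)) = (\<Prod>k<n. \<Sum>g\<in>G. F k g)"
proof (induction n arbitrary: F)
  case 0
  have "{h. h = [] \<and> set h \<subseteq> G} = {[]}" by auto
  then show ?case by simp
next
  case (Suc n)
  have "(\<Sum>h | length h = Suc n \<and> set h \<subseteq> G. \<Prod>k<Suc n. F k (h ! k)) =
      (\<Sum>(g, h)\<in>G \<times> {h. length h = n \<and> set h \<subseteq> G}. F 0 g * (\<Prod>k<n. F (Suc k) (h ! k)))"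
    by (rule sum.reindex_bij_witness[of _ "\<lambda>(g, h). g # h" "\<lambda>h. (hd h, tl h)"])
      (auto simp: length_Suc_conv prod.lessThan_Suc_shift simp del: prod.lessThan_Suc)
  also have "\<dots> = (\<Sum>g\<in>G. F 0 g) * (\<Sum>h | length h = n \<and> set h \<subseteq> G. \<Prod>k<n. F (Suc k) (h ! k))"
    by (simp add: sum_product sum.cartesian_product)
  also have "\<dots> = (\<Prod>k<Suc n. \<Sum>g\<in>G. F k g)"
    by (simp only: Suc.IH[of "\<lambda>k. F (Suc k)"] prod.lessThan_Suc_shift)
  finally show ?case .
qed

lemma prod_nth_eq_prod_list: "(\<Prod>k<length u. F (u ! k)) = prod_list (map F u)"
  by (induction u) (simp_all add: prod.lessThan_Suc_shift del: prod.lessThan_Suc)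

text \<open>Substituting linear forms and then giving the commuting value \<open>V g\<close> to each
  new letter is the same as giving each old letter the value of its linear form. An associator
  placed on bundles of strands is thereby reduced to \<open>cev\<close> of the associator
  itself.\<close>

lemma sum_subst_eq_cev:
  assumes "finite G"
  shows "(\<Sum>h | length h = n \<and> set h \<subseteq> G. scalar (nc_subst f x h) * (\<Prod>k<n. V (h ! k))) =
    cev (\<lambda>b. \<Sum>g\<in>G. scalar (x b g) * V g) f n"
proof -
  let ?H = "{h. length h = n \<and> set h \<subseteq> G}"
  have "(\<Sum>h\<in>?H. scalar (nc_subst f x h) * (\<Prod>k<n. V (h ! k))) =
      (\<Sum>h\<in>?H. \<Sum>u\<in>words n. scalar (f u) * (\<Prod>k<n. scalar (x (u ! k) (h ! k)) * V (h ! k)))"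
    by (rule sum.cong)
      (auto simp: nc_subst_def words_def scalar_sum scalar_mult scalar_prod sum_distrib_right
        prod.distrib mult.assoc)
  also have "\<dots> = (\<Sum>u\<in>words n. scalar (f u) * (\<Sum>h\<in>?H. \<Prod>k<n. scalar (x (u ! k) (h ! k)) * V (h ! k)))"
    by (subst sum.swap) (simp add: sum_distrib_left)
  also have "\<dots> = (\<Sum>u\<in>words n. scalar (f u) * (\<Prod>k<n. \<Sum>g\<in>G. scalar (x (u ! k) g) * V g))"
    by (simp only: sum_lists_prod[OF assms, where F = "\<lambda>k g. scalar (x (u ! k) g) * V g" for u])
  also have "\<dots> = cev (\<lambda>b. \<Sum>g\<in>G. scalar (x b g) * V g) f n"
    unfolding cev_def
    by (intro sum.cong refl) (auto simp: words_def prod_nth_eq_prod_list[where F = "\<lambda>b. \<Sum>g\<in>G. scalar (x b g) * V g"])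
  finally show ?thesis .
qed

section \<open>Words obtained from wheels by STU\<close>

definition chord_word :: "nat list \<Rightarrow> bool" where
  "chord_word w \<longleftrightarrow> (\<forall>x\<in>set w. count_list w x = 2)"

lemma chord_word_iff: "chord_word w \<longleftrightarrow> (\<forall>x. count_list w x \<in> {0, 2})"
  by (auto simp: chord_word_def count_list_0_iff)

lemma chord_word_Nil [simp]: "chord_word []"
  by (simp add: chord_word_def)

lemma replace_letter_simps [simp]:
  "replace_letter a u [] = []"
  "replace_letter a u (y # w) = (if y = a then u else [y]) @ replace_letter a u w"
  by (simp_all add: replace_letter_def)

lemma count_list_replace_letter:
  "count_list (replace_letter a u w) x =
     count_list w a * count_list u x + (if x = a then 0 else count_list w x)"
  by (induction w) (auto simp: algebra_simps)

lemma length_replace_letter: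
  "length (replace_letter a [b, c] w) = length w + count_list w a"
  by (induction w) auto

definition inner_ends :: "(nat \<times> nat \<times> nat) list \<Rightarrow> nat list" where
  "inner_ends vs = concat (map (\<lambda>(a, b, c). [b, c]) vs)"

text \<open>Every edge has two ends, counted on the line and at the vertices still to be resolved.\<close>

definition stu_ready :: "(nat \<times> nat \<times> nat) list \<Rightarrow> nat list \<Rightarrow> bool" where
  "stu_ready vs w \<longleftrightarrow> distinct (map fst vs) \<and>
     (\<forall>x. if x \<in> fst ` set vs then count_list w x = 1 \<and> count_list (inner_ends vs) x = 0
          else count_list w x + count_list (inner_ends vs) x \<in> {0, 2})"

text \<open>Resolving a vertex removes its leg \<open>a\<close> from the line and moves the ends
  \<open>b\<close> and \<open>c\<close> from the vertex to the line, so the number of ends of each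
  remaining edge is unchanged. That \<open>a\<close> lies on the line exactly once makes the word
  grow by one letter.\<close>

lemma stu_ready_step:
  assumes "stu_ready ((a, b, c) # vs) w" "u = [b, c] \<or> u = [c, b]"
  shows "stu_ready vs (replace_letter a u w)" "count_list w a = 1"
proof -
  let ?vs = "(a, b, c) # vs"
  have d: "distinct (map fst vs)" "a \<notin> fst ` set vs"
    using assms(1) by (auto simp: stu_ready_def)
  have *: "if x \<in> fst ` set ?vs then count_list w x = 1 \<and> count_list (inner_ends ?vs) x = 0
          else count_list w x + count_list (inner_ends ?vs) x \<in> {0, 2}" for x
    using assms(1) unfolding stu_ready_def by blast
  have i: "count_list (inner_ends ?vs) x = count_list u x + count_list (inner_ends vs) x" for x
    using assms(2) by (auto simp: inner_ends_def)
  show a: "count_list w a = 1" using *[of a] by auto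
  have "if x \<in> fst ` set vs
      then count_list (replace_letter a u w) x = 1 \<and> count_list (inner_ends vs) x = 0
      else count_list (replace_letter a u w) x + count_list (inner_ends vs) x \<in> {0, 2}" for x
    using *[of x] *[of a] d(2) a unfolding i count_list_replace_letter
    by (cases "x = a"; cases "x \<in> fst ` set vs") (simp_all add: add_ac)
  with d(1) show "stu_ready vs (replace_letter a u w)"
    unfolding stu_ready_def by blast
qed

text \<open>When no vertex is left, all ends lie on the line, so each label occurs there twice or
  not at all.\<close>

lemma keys_stu_resolve:
  assumes "v \<in> Poly_Mapping.keys (stu_resolve vs w)" "stu_ready vs w"
  shows "chord_word v \<and> length v = length w + length vs"
  using assms
proof (induction vs w rule: stu_resolve.induct)
  case (1 w)
  then have "v = w" by simp
  with 1 show ?case by (auto simp: chord_word_iff stu_ready_def inner_ends_def)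
next
  case (2 a b c vs w)
  have "v \<in> Poly_Mapping.keys (stu_resolve vs (replace_letter a [b, c] w)) \<or>
      v \<in> Poly_Mapping.keys (stu_resolve vs (replace_letter a [c, b] w))"
    using "2.prems"(1) keys_diff_subset by fastforce
  moreover have "length (replace_letter a u w) = length w + 1" if "u = [b, c] \<or> u = [c, b]" for u
    using that stu_ready_step(2)[OF "2.prems"(2) that] by (auto simp: length_replace_letter)
  ultimately show ?case
    using stu_ready_step(1)[OF "2.prems"(2)] "2.IH" by auto
qed

text \<open>The difference is 1 - 1 at the vertex resolved last and 0 - 0 at the others.\<close>

lemma ev_stu_resolve: "ev (\<lambda>_. 1) (stu_resolve vs w) = (if vs = [] then 1 else 0)"
  by (induction vs w rule: stu_resolve.induct) (simp_all add: ev_diff)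

lemma image_Suc_mod: "(\<lambda>k. Suc k mod s) ` {0..<s} = {0..<s}"
proof (intro endo_inj_surj inj_onI)
  fix k l assume "k \<in> {0..<s}" "l \<in> {0..<s}" "Suc k mod s = Suc l mod s"
  then show "k = l"
    by (auto simp: mod_Suc split: if_splits)
qed auto

text \<open>Each rim edge ends at two neighbouring vertices, once as second and once as third entry
  of a triple. The cyclic shift by one only permutes the rim edges, so both entries run through the
  same multiset \<open>M\<close>.\<close>

lemma mset_inner_ends_wheel:
  "mset (inner_ends (wheel off s)) = (let M = mset (map (\<lambda>k. 2 * k + 1) [off..<off + s]) in M + M)"
proof -
  have *: "mset (inner_ends (map (\<lambda>k. (f k, g k, h k)) ks)) = mset (map g ks) + mset (map h ks)"
    for f g h :: "nat \<Rightarrow> nat" and ks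
    by (induction ks) (auto simp: inner_ends_def)
  have "inj_on (\<lambda>k. Suc k mod s) {0..<s}"
    by (intro eq_card_imp_inj_on) (auto simp: image_Suc_mod)
  then have "image_mset (\<lambda>k. Suc k mod s) (mset_set {0..<s}) = mset_set {0..<s}"
    by (simp add: image_mset_mset_set image_Suc_mod)
  then have "image_mset (\<lambda>k. 2 * (off + k) + 1) (image_mset (\<lambda>k. Suc k mod s) (mset_set {0..<s})) =
      image_mset (\<lambda>k. 2 * (off + k) + 1) (mset_set {0..<s})" by simp
  then have 1: "mset (map (\<lambda>k. 2 * (off + Suc k mod s) + 1) [0..<s]) = mset (map (\<lambda>k. 2 * (off + k) + 1) [0..<s])"
    by (simp add: multiset.map_comp comp_def)
  have 2: "map (\<lambda>k. 2 * (off + k) + 1) [0..<s] = map (\<lambda>k. 2 * k + 1) [off..<off + s]"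
    by (rule nth_equalityI) auto
  show ?thesis
    unfolding wheel_def * 1 unfolding 2 by (simp add: Let_def)
qed

lemma map_fst_wheels:
  "map fst (wheels off ss) = map (\<lambda>k. 2 * k) [off..<off + sum_list ss]"
proof (induction off ss rule: wheels.induct)
  case (2 off s ss)
  have "map fst (wheel off s) = map (\<lambda>k. 2 * k) [off..<off + s]"
    by (rule nth_equalityI) (auto simp: wheel_def)
  moreover have "[off..<off + (s + sum_list ss)] = [off..<off + s] @ [off + s..<off + s + sum_list ss]"
    by (metis add.assoc le_add1 upt_add_eq_append)
  ultimately show ?case using 2 by simp
qed simp

lemma mset_inner_ends_wheels:
  "mset (inner_ends (wheels off ss)) =
     (let M = mset (map (\<lambda>k. 2 * k + 1) [off..<off + sum_list ss]) in M + M)"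
proof (induction off ss rule: wheels.induct)
  case (2 off s ss)
  have "[off..<off + (s + sum_list ss)] = [off..<off + s] @ [off + s..<off + s + sum_list ss]"
    by (metis add.assoc le_add1 upt_add_eq_append)
  moreover have "inner_ends (vs @ vs') = inner_ends vs @ inner_ends vs'" for vs vs'
    by (simp add: inner_ends_def)
  ultimately show ?case using 2 mset_inner_ends_wheel[of off s] by (simp add: Let_def)
qed (simp add: inner_ends_def)

text \<open>Legs have even labels and lie once on the line; rim edges have odd labels and have both
  ends at vertices. Parity keeps the two cases apart.\<close>

lemma stu_ready_wheels:
  assumes "distinct w" "set w = fst ` set (wheels off ss)"
  shows "stu_ready (wheels off ss) w"
proof -
  let ?vs = "wheels off ss"
  let ?O = "map (\<lambda>k. 2 * k + 1) [off..<off + sum_list ss]"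
  have d: "distinct ?O" "distinct (map fst ?vs)"
    by (auto simp: map_fst_wheels distinct_map inj_on_def)
  have "count_list (inner_ends ?vs) x = count_list ?O x + count_list ?O x" for x
    using mset_inner_ends_wheels[of off ss] by (simp add: Let_def flip: count_mset)
  then have c: "count_list (inner_ends ?vs) x = (if x \<in> set ?O then 2 else 0)" for x
    using distinct_count_atmost_1[of ?O] d(1) by (auto simp flip: count_mset)
  have w: "count_list w x = (if x \<in> fst ` set ?vs then 1 else 0)" for x
    using distinct_count_atmost_1[of w] assms by (auto simp flip: count_mset)
  have e: "x \<notin> set ?O" if "x \<in> fst ` set ?vs" for x
  proof -
    from that have "x \<in> set (map fst ?vs)" by simp
    then have "even x" unfolding map_fst_wheels by auto
    then show ?thesis by auto
  qed
  show ?thesis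
    unfolding stu_ready_def using d(2) e by (auto simp: c w)
qed

text \<open>A union of wheels has as many vertices as legs, and each resolution adds one letter to
  the word of legs, whose length therefore doubles.\<close>

lemma keys_chi_wheels:
  assumes "v \<in> Poly_Mapping.keys (chi (wheels off ss))"
  shows "chord_word v \<and> length v = 2 * sum_list ss"
proof -
  let ?vs = "wheels off ss"
  from assms have "v \<in> Poly_Mapping.keys (\<Sum>w\<in>permutations_of_set (fst ` set ?vs). stu_resolve ?vs w)"
    unfolding chi_def Let_def using keys_scale_subset[of "\<lambda>c. c / _"] by fastforce
  then obtain w where w: "w \<in> permutations_of_set (fst ` set ?vs)" "v \<in> Poly_Mapping.keys (stu_resolve ?vs w)"
    using keys_sum_subset by fastforce
  then have dw: "distinct w" "set w = fst ` set ?vs"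
    by (auto simp: permutations_of_set_def)
  have l: "length (map fst ?vs) = sum_list ss" "distinct (map fst ?vs)"
    unfolding map_fst_wheels by (auto simp: distinct_map inj_on_def)
  have "length w = card (set (map fst ?vs))"
    using dw distinct_card[of w] by simp
  then have "length w = sum_list ss" using l distinct_card by metis
  with keys_stu_resolve[OF w(2) stu_ready_wheels[OF dw]] l(1) show ?thesis by simp
qed

lemma keys_nu:
  assumes "v \<in> Poly_Mapping.keys (nu d)"
  shows "chord_word v \<and> length v = 2 * d"
proof -
  obtain ns where ns: "2 * sum_list ns = d"
    and v: "v \<in> Poly_Mapping.keys (Poly_Mapping.map (\<lambda>c. (\<Prod>n\<leftarrow>ns. wheel_coeff (2 * n)) / fact (length ns) * c)
       (chi (wheels 0 (map (\<lambda>n. 2 * n) ns))))"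
    using assms keys_sum_subset unfolding nu_def by fastforce
  from v have "v \<in> Poly_Mapping.keys (chi (wheels 0 (map (\<lambda>n. 2 * n) ns)))"
    using keys_scale_subset[of "\<lambda>c. _ * c"] by fastforce
  from keys_chi_wheels[OF this] ns show ?thesis
    by (simp add: sum_list_const_mult)
qed

lemma ev_chi: "ev (\<lambda>_. 1) (chi vs) = (if vs = [] then 1 else 0)"
proof -
  have "ev (\<lambda>_. 1) (chi vs) = scalar (1 / of_nat (card (permutations_of_set (fst ` set vs)))) *
      (\<Sum>w\<in>permutations_of_set (fst ` set vs). if vs = [] then 1 else 0)"
    by (simp add: chi_def Let_def ev_scale_divide ev_sum ev_stu_resolve)
  then show ?thesis by auto
qed

lemma ev_nu: "ev (\<lambda>_. 1) (nu d) = (if d = 0 then 1 else 0)"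
proof -
  let ?N = "{ns. (\<forall>n\<in>set ns. 1 \<le> n) \<and> 2 * sum_list ns = d}"
  let ?c = "\<lambda>ns. (\<Prod>n\<leftarrow>ns. wheel_coeff (2 * n)) / fact (length ns)"
  \<comment> \<open>The condition \<open>1 \<le> n\<close> excludes wheels without legs, whose list
    of vertices would be empty.\<close>
  have w: "wheels 0 (map (\<lambda>n. 2 * n) ns) = [] \<longleftrightarrow> ns = []" if "\<forall>n\<in>set ns. 1 \<le> n" for ns
    using that by (cases ns) (auto simp: wheel_def)
  have "ev (\<lambda>_. 1) (nu d) = (\<Sum>ns\<in>?N. scalar (?c ns) * (if ns = [] then 1 else 0))"
    unfolding nu_def ev_sum by (rule sum.cong) (auto simp: ev_scale ev_chi w)
  also have "\<dots> = (if d = 0 then 1 else 0)"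
  proof (cases "d = 0")
    case True
    then have "?N = {[]}" by (auto simp: sum_list_eq_0_iff) (metis neq_Nil_conv list.set_intros(1) not_less_eq_eq le0)
    then show ?thesis using True by simp
  next
    case False
    then show ?thesis by (auto intro!: sum.neutral)
  qed
  finally show ?thesis .
qed

section \<open>The square root of \<nu>\<close>

lemma chord_word_concat:
  assumes "chord_word v" "chord_word w"
  shows "chord_word (word_concat v w)"
proof -
  have e: "count_list (map (\<lambda>x. 2 * x) v) x = (if even x then count_list v (x div 2) else 0)" for x and v :: "nat list"
    by (induction v) (auto, presburger)
  have o: "count_list (map (\<lambda>x. Suc (2 * x)) v) x = (if odd x then count_list v (x div 2) else 0)" for x and v :: "nat list"
    by (induction v) (auto, presburger)
  show ?thesis
    using assms unfolding chord_word_iff by (auto simp: word_concat_def e o)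
qed

lemma keys_word_pow:
  assumes "\<And>d v. v \<in> Poly_Mapping.keys (a d) \<Longrightarrow> chord_word v \<and> length v = 2 * d"
    and "v \<in> Poly_Mapping.keys (word_pow a k n)"
  shows "chord_word v \<and> length v = 2 * n"
  using assms(2)
proof (induction k arbitrary: n v)
  case 0
  then show ?case by (auto simp: series_unit_def split: if_splits)
next
  case (Suc k)
  from Suc.prems obtain l x y where "l \<le> n" "x \<in> Poly_Mapping.keys (a l)"
    "y \<in> Poly_Mapping.keys (word_pow a k (n - l))" "v = word_concat x y"
    by (auto elim: keys_series_prodE)
  with assms(1) Suc.IH show ?case
    by (auto simp: chord_word_concat) (auto simp: word_concat_def)
qed

lemma keys_sqrt_nu:
  assumes "v \<in> Poly_Mapping.keys (sqrt_nu n)"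
  shows "chord_word v \<and> length v = 2 * n"
proof -
  obtain k where "v \<in> Poly_Mapping.keys (Poly_Mapping.map (\<lambda>c. ((1/2) gchoose k) * c)
     (word_pow (\<lambda>d. nu d - series_unit [] d) k n))"
    using assms keys_sum_subset unfolding sqrt_nu_def by fastforce
  then have "v \<in> Poly_Mapping.keys (word_pow (\<lambda>d. nu d - series_unit [] d) k n)"
    using keys_scale_subset[of "\<lambda>c. _ * c"] by fastforce
  then show ?thesis
  proof (rule keys_word_pow[rotated])
    fix d v assume "v \<in> Poly_Mapping.keys (nu d - series_unit [] d)"
    then have "v \<in> Poly_Mapping.keys (nu d) \<or> v \<in> Poly_Mapping.keys (series_unit [] d)"
      using keys_diff_subset by fastforce
    then show "chord_word v \<and> length v = 2 * d"
      using keys_nu[of v d] by (auto simp: series_unit_def split: if_splits)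
  qed
qed

lemma ev_series_unit: "ev w (series_unit x n) = (if n = 0 then w x else 0)"
  by (simp add: series_unit_def)

lemma ev_word_pow:
  assumes "\<And>d. ev (\<lambda>_. 1) (a d) = 0"
  shows "ev (\<lambda>_. 1) (word_pow a k n) = (if k = 0 \<and> n = 0 then 1 else 0)"
proof (cases k)
  case (Suc l)
  have "ev (\<lambda>_. 1) (series_prod word_concat a (word_pow a l) n) =
      (\<Sum>j\<le>n. ev (\<lambda>_. 1) (a j) * ev (\<lambda>_. 1) (word_pow a l (n - j)))"
    by (rule ev_series_prod) simp
  then show ?thesis using Suc assms by simp
qed (simp add: ev_series_unit)

text \<open>The sum of coefficients is multiplicative under concatenation and vanishes on \<nu> - 1
  in every degree, so the binomial series is reduced to its term \<open>k = 0\<close>.\<close>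

lemma ev_sqrt_nu: "ev (\<lambda>_. 1) (sqrt_nu n) = (if n = 0 then 1 else 0)"
proof -
  have *: "ev (\<lambda>_. 1) (nu d - series_unit [] d) = 0" for d
    by (simp add: ev_diff ev_nu ev_series_unit)
  show ?thesis
    unfolding sqrt_nu_def ev_sum ev_scale ev_word_pow[OF *] by simp
qed

section \<open>Chord types of a tangle diagram\<close>

text \<open>In \<open>K\<close> each chord end is a pair of a chord label and a component; the order
  of the ends along the strands is forgotten. When the label \<open>x\<close> has two ends,
  \<open>partners K x\<close> is the type of the chord \<open>x\<close>.\<close>

definition partners :: "(nat \<times> nat) multiset \<Rightarrow> nat \<Rightarrow> nat multiset" where
  "partners K x = image_mset snd (filter_mset (\<lambda>p. fst p = x) K)"

definition types :: "(nat \<times> nat) multiset \<Rightarrow> nat multiset multiset" where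
  "types K = image_mset (partners K) (mset_set (fst ` set_mset K))"

definition balanced :: "(nat \<times> nat) multiset \<Rightarrow> bool" where
  "balanced K \<longleftrightarrow> (\<forall>x\<in>fst ` set_mset K. size (partners K x) = 2)"

lemma partners_add: "partners (K + K') x = partners K x + partners K' x"
  by (simp add: partners_def)

lemma partners_empty:
  assumes "x \<notin> fst ` set_mset K"
  shows "partners K x = {#}"
proof -
  have "filter_mset (\<lambda>p. fst p = x) K = filter_mset (\<lambda>_. False) K"
    using assms by (intro filter_mset_cong) auto
  then show ?thesis by (simp add: partners_def)
qed

lemma types_empty [simp]: "types {#} = {#}"
  by (simp add: types_def)

lemma balanced_empty [simp]: "balanced {#}"
  by (simp add: balanced_def)

lemma types_add:
  assumes "fst ` set_mset K \<inter> fst ` set_mset K' = {}"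
  shows "types (K + K') = types K + types K'"
proof -
  have "image_mset (partners (K + K')) (mset_set (fst ` set_mset K)) = types K"
    unfolding types_def using assms
    by (intro image_mset_cong) (subst partners_add, subst partners_empty[of _ K'], auto)
  moreover have "image_mset (partners (K + K')) (mset_set (fst ` set_mset K')) = types K'"
    unfolding types_def using assms
    by (intro image_mset_cong) (subst partners_add, subst partners_empty[of _ K], auto)
  ultimately show ?thesis
    using assms by (simp add: types_def image_Un mset_set_Union)
qed

lemma balanced_add:
  assumes "fst ` set_mset K \<inter> fst ` set_mset K' = {}" "balanced K" "balanced K'"
  shows "balanced (K + K')"
  unfolding balanced_def
proof
  fix x assume "x \<in> fst ` set_mset (K + K')"
  then consider "x \<in> fst ` set_mset K" "x \<notin> fst ` set_mset K'"
    | "x \<notin> fst ` set_mset K" "x \<in> fst ` set_mset K'"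
    using assms(1) by (auto simp only: set_mset_union image_Un)
  then show "size (partners (K + K') x) = 2"
  proof cases
    case 1
    then have "partners (K + K') x = partners K x"
      using partners_empty[of x K'] by (simp add: partners_add del: image_iff)
    with 1 assms(2) show ?thesis by (simp only: balanced_def)
  next
    case 2
    then have "partners (K + K') x = partners K' x"
      using partners_empty[of x K] by (simp add: partners_add del: image_iff)
    with 2 assms(3) show ?thesis by (simp only: balanced_def)
  qed
qed

lemma partners_relabel:
  assumes "inj_on f (fst ` set_mset K)" "x \<in> fst ` set_mset K"
  shows "partners (image_mset (map_prod f id) K) (f x) = partners K x"
proof -
  have "filter_mset (\<lambda>p. f (fst p) = f x) K = filter_mset (\<lambda>p. fst p = x) K"
    using assms by (intro filter_mset_cong refl) (auto simp: inj_on_def)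
  then show ?thesis
    by (simp add: partners_def filter_mset_image_mset multiset.map_comp comp_def)
qed

lemma fst_image_relabel: "fst ` set_mset (image_mset (map_prod f id) K) = f ` fst ` set_mset K"
  by (simp add: image_image)

text \<open>Labels serve only to match the two ends of a chord, so any relabelling that keeps
  different labels apart leaves the types alone.\<close>

lemma types_relabel:
  assumes "inj_on f (fst ` set_mset K)"
  shows "types (image_mset (map_prod f id) K) = types K"
proof -
  have "types (image_mset (map_prod f id) K) =
      image_mset (\<lambda>x. partners (image_mset (map_prod f id) K) (f x)) (mset_set (fst ` set_mset K))"
    unfolding types_def fst_image_relabel
    by (simp add: multiset.map_comp comp_def flip: image_mset_mset_set[OF assms])
  also have "\<dots> = types K"
    unfolding types_def by (intro image_mset_cong) (simp add: partners_relabel[OF assms])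
  finally show ?thesis .
qed

lemma balanced_relabel:
  assumes "inj_on f (fst ` set_mset K)" "balanced K"
  shows "balanced (image_mset (map_prod f id) K)"
  using assms unfolding balanced_def fst_image_relabel by (auto simp: partners_relabel)

lemma partners_pair: "partners {#(x, c), (x, d)#} x = {#c, d#}"
  by (simp add: partners_def)

lemma types_chords:
  "types (\<Sum>k<n. {#(k, c k), (k, d k)#}) = (\<Sum>k<n. {#{#c k, d k#}#}) \<and>
   balanced (\<Sum>k<n. {#(k, c k), (k, d k)#})"
proof (induction n)
  case (Suc n)
  let ?K = "\<Sum>k<n. {#(k, c k), (k, d k)#}"
  have t: "types {#(n, c n), (n, d n)#} = {#{#c n, d n#}#}" "balanced {#(n, c n), (n, d n)#}"
    by (simp_all add: types_def balanced_def partners_pair)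
  have "fst ` set_mset ?K \<subseteq> {..<n}"
    by (induction n) auto
  then have "fst ` set_mset ?K \<inter> fst ` set_mset {#(n, c n), (n, d n)#} = {}"
    by auto
  from types_add[OF this] balanced_add[OF this] Suc t show ?case
    by (simp del: add_mset_add_single)
qed simp

definition ends_on :: "nat \<Rightarrow> nat list \<Rightarrow> (nat \<times> nat) multiset" where
  "ends_on c w = image_mset (\<lambda>x. (x, c)) (mset w)"

text \<open>Arcs and circles contribute alike. This makes the multiset invariant under gluing, which
  joins two arcs of one component or closes an arc to a circle.\<close>

definition ends :: "tangle_diagram \<Rightarrow> (nat \<times> nat) multiset" where
  "ends D = (\<Sum>a\<leftarrow>fst D. ends_on (arc_comp a) (arc_word a)) + (\<Sum>(c, w)\<leftarrow>snd D. ends_on c w)"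

lemma partners_ends_on: "partners (ends_on c w) x = replicate_mset (count_list w x) c"
  unfolding partners_def ends_on_def by (induction w) auto

lemma ends_altdef:
  "ends D = (\<Sum>a\<in>#mset (fst D). ends_on (arc_comp a) (arc_word a)) + (\<Sum>(c, w)\<in>#mset (snd D). ends_on c w)"
  unfolding ends_def by (simp flip: sum_mset_sum_list)

lemma ends_on_append: "ends_on c (v @ w) = ends_on c v + ends_on c w"
  by (simp add: ends_on_def)

lemma ends_on_Nil [simp]: "ends_on c [] = {#}"
  by (simp add: ends_on_def)

lemma ends_on_rev [simp]: "ends_on c (rev w) = ends_on c w"
  by (simp add: ends_on_def)

lemma ends_on_map: "ends_on c (map f w) = image_mset (map_prod f id) (ends_on c w)"
  by (simp add: ends_on_def multiset.map_comp comp_def)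

lemma image_mset_sum: "image_mset f (sum g A) = (\<Sum>x\<in>A. image_mset f (g x))"
  by (induction A rule: infinite_finite_induct) auto

lemma image_mset_sum_list: "image_mset f (sum_list Ks) = sum_list (map (image_mset f) Ks)"
  by (induction Ks) auto

lemma ends_map_diagram: "ends (map_diagram \<pi> f D) = image_mset (map_prod f id) (ends D)"
  by (simp add: ends_def map_diagram_def image_mset_sum_list comp_def case_prod_beta ends_on_map)

lemma ends_disjoint_union:
  "ends (disjoint_union D E) =
     image_mset (map_prod (\<lambda>x. 2 * x) id) (ends D) + image_mset (map_prod (\<lambda>x. 2 * x + 1) id) (ends E)"
proof -
  have "ends (disjoint_union D E) =
      ends (map_diagram id (\<lambda>x. 2 * x) D) + ends (map_diagram id (\<lambda>x. 2 * x + 1) E)"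
    by (simp add: ends_def disjoint_union_def Let_def)
  then show ?thesis by (simp only: ends_map_diagram)
qed

definition chord_types :: "tangle_diagram \<Rightarrow> nat multiset multiset" where
  "chord_types D = types (ends D)"

lemma disjoint_union_chords:
  "chord_types (disjoint_union D E) = chord_types D + chord_types E"
  "balanced (ends D) \<Longrightarrow> balanced (ends E) \<Longrightarrow> balanced (ends (disjoint_union D E))"
proof -
  let ?K = "image_mset (map_prod (\<lambda>x. 2 * x) id) (ends D)"
  let ?K' = "image_mset (map_prod (\<lambda>x. 2 * x + 1) id) (ends E)"
  have "2 * x \<noteq> 2 * y + 1" for x y :: nat by presburger
  then have d: "fst ` set_mset ?K \<inter> fst ` set_mset ?K' = {}"
    unfolding fst_image_relabel by blast
  have i: "inj_on (\<lambda>x. 2 * x) A" "inj_on (\<lambda>x. 2 * x + 1) A" for A :: "nat set"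
    by (auto simp: inj_on_def)
  show "chord_types (disjoint_union D E) = chord_types D + chord_types E"
    unfolding chord_types_def ends_disjoint_union types_add[OF d] by (simp only: types_relabel i)
  show "balanced (ends (disjoint_union D E))" if "balanced (ends D)" "balanced (ends E)"
    unfolding ends_disjoint_union using that by (intro balanced_add d balanced_relabel i)
qed

text \<open>The underlying 1-manifold. It provides the comparison with \<open>skeleton\<close>,
  through which the ports of a diagram and the numbering of its circles become known.\<close>

definition erase :: "tangle_diagram \<Rightarrow> tangle_diagram" where
  "erase D = (map (\<lambda>a. Arc (arc_source a) (arc_target a) (arc_comp a) []) (fst D),
              map (\<lambda>(c, w). (c, [])) (snd D))"

text \<open>The map \<open>g\<close> is arbitrary because the erased words are empty.\<close>

lemma erase_map_diagram: "erase (map_diagram \<pi> f D) = map_diagram \<pi> g (erase D)"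
  by (auto simp: erase_def map_diagram_def)

lemma erase_disjoint_union: "erase (disjoint_union D E) = disjoint_union (erase D) (erase E)"
proof -
  have "erase (disjoint_union D E) =
     (fst (erase (map_diagram id (\<lambda>x. 2 * x) D)) @ fst (erase (map_diagram id (\<lambda>x. 2 * x + 1) E)),
      snd (erase (map_diagram id (\<lambda>x. 2 * x) D)) @ snd (erase (map_diagram id (\<lambda>x. 2 * x + 1) E)))"
    by (simp add: disjoint_union_def Let_def erase_def)
  also have "\<dots> = disjoint_union (erase D) (erase E)"
    by (simp add: disjoint_union_def Let_def erase_map_diagram[where D = D and g = "\<lambda>x. 2 * x"]
        erase_map_diagram[where D = E and g = "\<lambda>x. 2 * x + 1"])
  finally show ?thesis .
qed

section \<open>Gluing\<close>

definition source_of :: "arc \<Rightarrow> port \<times> nat" where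
  "source_of a = (arc_source a, arc_comp a)"

definition target_of :: "arc \<Rightarrow> port \<times> nat" where
  "target_of a = (arc_target a, arc_comp a)"

definition ported ::
    "(port \<times> nat) multiset \<Rightarrow> (port \<times> nat) multiset \<Rightarrow> tangle_diagram \<Rightarrow> bool" where
  "ported P Q D \<longleftrightarrow> image_mset source_of (mset (fst D)) = P \<and> image_mset target_of (mset (fst D)) = Q"

text \<open>The bound concerns the ports without their component numbers. It is what makes the
  search for an arc at a given port unambiguous.\<close>

definition simple_ports :: "(port \<times> nat) multiset \<Rightarrow> bool" where
  "simple_ports P \<longleftrightarrow> (\<forall>x. count (image_mset fst P) x \<le> 1)"

lemma simple_ports_unique:
  assumes "simple_ports P" "(x, c) \<in># P" "(x, d) \<in># P"
  shows "c = d"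
proof (rule ccontr)
  assume "c \<noteq> d"
  with assms(2,3) obtain R where "P = add_mset (x, c) (add_mset (x, d) R)"
    by (metis insert_noteq_member mset_add prod.inject)
  then have "count (image_mset fst P) x \<ge> 2" by simp
  with assms(1) show False by (force simp: simple_ports_def dest: spec[of _ x])
qed

lemma simple_ports_subset: "simple_ports P \<Longrightarrow> P' \<subseteq># P \<Longrightarrow> simple_ports P'"
  unfolding simple_ports_def by (meson image_mset_subseteq_mono mset_subset_eq_count order_trans)

lemma ported_erase: "ported P Q (erase D) \<longleftrightarrow> ported P Q D"
  by (simp add: ported_def erase_def multiset.map_comp comp_def source_of_def[abs_def] target_of_def[abs_def])

lemma find_SomeD: "find Q xs = Some x \<Longrightarrow> x \<in> set xs \<and> Q x"
  by (induction xs) (auto split: if_splits)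

lemma find_map: "find Q (map f xs) = map_option f (find (Q \<circ> f) xs)"
  by (induction xs) auto

lemma map_remove1_inj_on:
  "inj_on f (insert x (set xs)) \<Longrightarrow> map f (remove1 x xs) = remove1 (f x) (map f xs)"
  by (induction xs) (auto simp: inj_on_def)

lemma distinct_if_count_le_1: "(\<And>x. count (mset xs) x \<le> 1) \<Longrightarrow> distinct xs"
proof (induction xs)
  case (Cons y xs)
  have "count (mset xs) x \<le> 1" for x
    using Cons.prems[of x] by (cases "x = y") (auto simp: count_mset)
  moreover have "y \<notin> set xs"
    using Cons.prems[of y] by (auto simp flip: count_greater_zero_iff)
  ultimately show ?case using Cons.IH by simp
qed simp

lemma mset_eq_add_remove1: "x \<in> set xs \<Longrightarrow> mset xs = add_mset x (mset (remove1 x xs))"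
  by simp

text \<open>The middle point \<open>Mid i\<close> occurs among the sources and among the targets, so
  both searches succeed. The two arcs found coincide exactly when gluing closes up a circle.\<close>

lemma glue_cases:
  assumes "ported P Q D" "simple_ports P" "simple_ports Q" "(Mid i, c) \<in># P" "(Mid i, c) \<in># Q"
  obtains a where "a \<in> set (fst D)" "source_of a = (Mid i, c)" "target_of a = (Mid i, c)"
      "find (\<lambda>a. arc_target a = Mid i) (fst D) = Some a"
      "find (\<lambda>a. arc_source a = Mid i) (fst D) = Some a"
      "glue i D = (remove1 a (fst D), snd D @ [(arc_comp a, arc_word a)])"
    | a b where "a \<noteq> b" "a \<in> set (fst D)" "b \<in> set (fst D)"
      "source_of b = (Mid i, c)" "target_of a = (Mid i, c)"
      "find (\<lambda>a. arc_target a = Mid i) (fst D) = Some a"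
      "find (\<lambda>a. arc_source a = Mid i) (fst D) = Some b"
      "glue i D = (Arc (arc_source a) (arc_target b) (arc_comp a) (arc_word a @ arc_word b)
                  # remove1 a (remove1 b (fst D)), snd D)"
proof -
  obtain a where a: "find (\<lambda>a. arc_target a = Mid i) (fst D) = Some a"
    using assms(1,5)
    by (cases "find (\<lambda>a. arc_target a = Mid i) (fst D)") (force simp: ported_def target_of_def find_None_iff)+
  obtain b where b: "find (\<lambda>a. arc_source a = Mid i) (fst D) = Some b"
    using assms(1,4)
    by (cases "find (\<lambda>a. arc_source a = Mid i) (fst D)") (force simp: ported_def source_of_def find_None_iff)+
  have a': "a \<in> set (fst D)" "arc_target a = Mid i" and b': "b \<in> set (fst D)" "arc_source b = Mid i"
    using find_SomeD a b by fast+
  have "target_of a \<in># Q" "source_of b \<in># P"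
    using assms(1) a'(1) b'(1) by (auto simp: ported_def)
  \<comment> \<open>A port occurs with only one component number, so the arcs meeting at
    \<open>Mid i\<close> belong to the same component.\<close>
  then have "arc_comp a = c" "arc_comp b = c"
    using simple_ports_unique[OF assms(2) _ assms(4)] simple_ports_unique[OF assms(3) _ assms(5)] a' b'
    by (auto simp: target_of_def source_of_def)
  with a' b' have t: "target_of a = (Mid i, c)" "source_of b = (Mid i, c)"
    by (auto simp: target_of_def source_of_def)
  show thesis
  proof (cases "a = b")
    case True
    have "glue i D = (remove1 a (fst D), snd D @ [(arc_comp a, arc_word a)])"
      using True a b by (simp add: glue_def case_prod_beta)
    with True a b a'(1) t show thesis by (intro that(1)) simp_all
  next
    case False
    then have "glue i D = (Arc (arc_source a) (arc_target b) (arc_comp a) (arc_word a @ arc_word b)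
        # remove1 a (remove1 b (fst D)), snd D)"
      using a b by (simp add: glue_def case_prod_beta)
    with False a b a'(1) b'(1) t show thesis by (intro that(2)) simp_all
  qed
qed

text \<open>Concatenating words adds up their ends, and since the arcs joined agree in their
  component, no end changes its component.\<close>

lemma glue_ported:
  assumes "ported P Q D" "simple_ports P" "simple_ports Q" "(Mid i, c) \<in># P" "(Mid i, c) \<in># Q"
  shows "ported (P - {#(Mid i, c)#}) (Q - {#(Mid i, c)#}) (glue i D)" (is ?ported)
    and "ends (glue i D) = ends D" (is ?ends)
proof -
  from assms have "?ported \<and> ?ends"
  proof (cases rule: glue_cases)
    case (1 a)
    define rs where "rs = remove1 a (fst D)"
    have m: "mset (fst D) = add_mset a (mset rs)"
      using 1(1) by (simp add: rs_def)
    have "?ported"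
      using assms(1) 1(2,3) unfolding ported_def 1(6) fst_conv rs_def[symmetric] m by auto
    moreover have ?ends
      unfolding ends_altdef 1(6) fst_conv snd_conv rs_def[symmetric] m by simp
    ultimately show ?thesis by simp
  next
    case (2 a b)
    define rs where "rs = remove1 a (remove1 b (fst D))"
    have a: "a \<in> set (remove1 b (fst D))" using 2(1,2) by simp
    have m: "mset (fst D) = add_mset a (add_mset b (mset rs))"
      using mset_eq_add_remove1[OF 2(3)] mset_eq_add_remove1[OF a]
      by (simp add: rs_def add_mset_commute del: mset_remove1)
    have "?ported"
      using assms(1) 2(4,5) unfolding ported_def 2(8) fst_conv rs_def[symmetric] m
      by (auto simp: source_of_def target_of_def)
    moreover have ?ends
      using 2(4,5) unfolding ends_altdef 2(8) fst_conv snd_conv rs_def[symmetric] m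
      by (simp add: ends_on_append source_of_def target_of_def)
    ultimately show ?thesis by simp
  qed
  then show ?ported ?ends by auto
qed

text \<open>Erasing could identify two arcs, and \<open>remove1\<close> might then delete the wrong
  one. Arcs of a diagram with simple ports have different sources, so erasing is injective on
  them.\<close>

lemma glue_erase:
  assumes "ported P Q D" "simple_ports P" "simple_ports Q" "(Mid i, c) \<in># P" "(Mid i, c) \<in># Q"
  shows "erase (glue i D) = glue i (erase D)"
proof -
  let ?f = "\<lambda>a. Arc (arc_source a) (arc_target a) (arc_comp a) []"
  have "image_mset fst P = mset (map arc_source (fst D))"
    using assms(1) by (auto simp: ported_def source_of_def multiset.map_comp comp_def)
  then have "distinct (map arc_source (fst D))"
    using assms(2) by (intro distinct_if_count_le_1) (simp add: simple_ports_def)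
  then have inj: "inj_on ?f (set (fst D))"
    by (auto simp: distinct_map inj_on_def)
  have inj': "inj_on ?f A" if "A \<subseteq> set (fst D)" for A
    using inj that by (rule inj_on_subset)
  have f: "find (\<lambda>a. arc_target a = Mid i) (map ?f as) = map_option ?f (find (\<lambda>a. arc_target a = Mid i) as)"
      "find (\<lambda>a. arc_source a = Mid i) (map ?f as) = map_option ?f (find (\<lambda>a. arc_source a = Mid i) as)" for as
    by (simp_all add: find_map comp_def)
  from assms show ?thesis
  proof (cases rule: glue_cases)
    case (1 a)
    have "glue i (erase D) = (remove1 (?f a) (map ?f (fst D)), map (\<lambda>(c, w). (c, [])) (snd D) @ [(arc_comp a, [])])"
      unfolding glue_def erase_def by (simp add: f 1(4,5))
    moreover have "remove1 (?f a) (map ?f (fst D)) = map ?f (remove1 a (fst D))"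
      using 1(1) by (intro map_remove1_inj_on[symmetric] inj') auto
    ultimately show ?thesis
      unfolding 1(6) by (simp add: erase_def)
  next
    case (2 a b)
    have "?f a \<noteq> ?f b" using inj 2(1-3) by (auto simp: inj_on_def)
    then have "glue i (erase D) = (Arc (arc_source a) (arc_target b) (arc_comp a) []
        # remove1 (?f a) (remove1 (?f b) (map ?f (fst D))), map (\<lambda>(c, w). (c, [])) (snd D))"
      unfolding glue_def erase_def by (simp add: f 2(6,7))
    moreover have "remove1 (?f b) (map ?f (fst D)) = map ?f (remove1 b (fst D))"
      using 2(3) by (intro map_remove1_inj_on[symmetric] inj') auto
    moreover have "remove1 (?f a) (map ?f (remove1 b (fst D))) = map ?f (remove1 a (remove1 b (fst D)))"
      using 2(2) by (intro map_remove1_inj_on[symmetric] inj') (auto dest: set_remove1_subset[THEN subsetD])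
    ultimately show ?thesis
      unfolding 2(8) by (simp add: erase_def)
  qed
qed

text \<open>\<open>P\<close> and \<open>Q\<close> are the ports that survive all gluings; each step
  removes one middle port from the sources and one from the targets.\<close>

lemma fold_glue:
  assumes "ported (P + mset (map (\<lambda>i. (Mid i, \<kappa> i)) js)) (Q + mset (map (\<lambda>i. (Mid i, \<kappa> i)) js)) D"
    and "simple_ports (P + mset (map (\<lambda>i. (Mid i, \<kappa> i)) js))"
    and "simple_ports (Q + mset (map (\<lambda>i. (Mid i, \<kappa> i)) js))"
  shows "ported P Q (fold glue js D) \<and> ends (fold glue js D) = ends D \<and>
    erase (fold glue js D) = fold glue js (erase D)"
  using assms
proof (induction js arbitrary: D)
  case (Cons j js)
  let ?M = "mset (map (\<lambda>i. (Mid i, \<kappa> i)) (j # js))"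
  let ?M' = "mset (map (\<lambda>i. (Mid i, \<kappa> i)) js)"
  have in_M: "(Mid j, \<kappa> j) \<in># P + ?M" "(Mid j, \<kappa> j) \<in># Q + ?M" by auto
  have diff: "P + ?M - {#(Mid j, \<kappa> j)#} = P + ?M'" "Q + ?M - {#(Mid j, \<kappa> j)#} = Q + ?M'" by auto
  have "simple_ports (P + ?M')" "simple_ports (Q + ?M')"
    using Cons.prems(2,3) by (auto intro: simple_ports_subset)
  with Cons.IH[of "glue j D"] glue_ported[OF Cons.prems in_M] glue_erase[OF Cons.prems in_M]
  show ?case unfolding diff by simp
qed simp

section \<open>The invariant of q-tangles counting chord types\<close>

lemma mset_map_if:
  "mset (map (\<lambda>i. if q i then f i else g i) xs) = mset (map f (filter q xs)) + mset (map g (filter (\<lambda>i. \<not> q i) xs))"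
  by (induction xs) auto

definition strand_ports :: "(nat \<Rightarrow> port) \<Rightarrow> bool \<Rightarrow> strand list \<Rightarrow> (port \<times> nat) multiset" where
  "strand_ports f b ss = mset (map (\<lambda>i. (f i, snd (ss ! i))) (filter (\<lambda>i. fst (ss ! i) = b) [0..<length ss]))"

lemma strand_ports_Nil [simp]: "strand_ports f b [] = {#}"
  by (simp add: strand_ports_def)

lemma strand_ports_append:
  "strand_ports f b (ss @ ts) = strand_ports f b ss + strand_ports (\<lambda>i. f (length ss + i)) b ts"
proof -
  have "[0..<length (ss @ ts)] = [0..<length ss] @ map (\<lambda>i. length ss + i) [0..<length ts]"
    by (rule nth_equalityI) (auto simp: nth_append)
  moreover have "filter (\<lambda>i. fst ((ss @ ts) ! i) = b) [0..<length ss] = filter (\<lambda>i. fst (ss ! i) = b) [0..<length ss]"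
    by (rule filter_cong) (auto simp: nth_append)
  moreover have "map (\<lambda>i. (f i, snd ((ss @ ts) ! i))) (filter (\<lambda>i. fst (ss ! i) = b) [0..<length ss]) =
      map (\<lambda>i. (f i, snd (ss ! i))) (filter (\<lambda>i. fst (ss ! i) = b) [0..<length ss])"
    by (rule map_cong) (auto simp: nth_append)
  ultimately show ?thesis
    by (simp only: strand_ports_def filter_append map_append mset_append filter_map map_map)
      (simp add: comp_def)
qed

lemma image_strand_ports: "image_mset (map_prod \<pi> id) (strand_ports f b ss) = strand_ports (\<lambda>i. \<pi> (f i)) b ss"
  by (simp add: strand_ports_def multiset.map_comp comp_def)

lemma strand_ports_both:
  "strand_ports f b ss + strand_ports f (\<not> b) ss = mset (map (\<lambda>i. (f i, snd (ss ! i))) [0..<length ss])"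
proof -
  have "filter (\<lambda>i. fst (ss ! i) = (\<not> b)) [0..<length ss] = filter (\<lambda>i. fst (ss ! i) \<noteq> b) [0..<length ss]"
    by (rule filter_cong) auto
  then show ?thesis
    unfolding strand_ports_def
    using mset_map_if[of "\<lambda>i. fst (ss ! i) = b" "\<lambda>i. (f i, snd (ss ! i))" "\<lambda>i. (f i, snd (ss ! i))" "[0..<length ss]"]
    by simp
qed

lemma count_strand_ports:
  assumes "inj f"
  shows "count (image_mset fst (strand_ports f b ss)) x \<le> (if x \<in> range f then 1 else 0)"
proof -
  let ?xs = "map f (filter (\<lambda>i. fst (ss ! i) = b) [0..<length ss])"
  have "distinct ?xs" using assms by (auto simp: distinct_map inj_on_def)
  then have "count (mset ?xs) x = (if x \<in> set ?xs then 1 else 0)"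
    by (simp add: distinct_count_atmost_1 del: mset_map set_map)
  moreover have "image_mset fst (strand_ports f b ss) = mset ?xs"
    by (simp add: strand_ports_def multiset.map_comp comp_def)
  ultimately show ?thesis by auto
qed

text \<open>The three kinds of ports have disjoint ranges, and on each of them different positions
  give different ports.\<close>

lemma simple_boundary_ports:
  fixes \<kappa> :: "nat \<Rightarrow> nat" and n :: nat
  defines "M \<equiv> mset (map (\<lambda>i. (Mid i, \<kappa> i)) [0..<n])"
  shows "simple_ports (strand_ports Bot b ss + strand_ports Top c ts + M)"
  unfolding simple_ports_def
proof
  fix x
  have "image_mset fst M = mset (map Mid [0..<n])"
    by (simp add: M_def multiset.map_comp comp_def)
  moreover have "distinct (map Mid [0..<n])" by (simp add: distinct_map inj_on_def)
  ultimately have "count (image_mset fst M) x = (if x \<in> set (map Mid [0..<n]) then 1 else 0)"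
    by (simp only: distinct_count_atmost_1)
  then have "count (image_mset fst M) x \<le> (if x \<in> range Mid then 1 else 0)"
    by auto
  moreover have "inj Bot" "inj Top" by (auto simp: inj_def)
  ultimately show "count (image_mset fst (strand_ports Bot b ss + strand_ports Top c ts + M)) x \<le> 1"
    using count_strand_ports[of Bot b ss x] count_strand_ports[of Top c ts x]
    by (cases x) (auto simp: image_iff)
qed

text \<open>An arc starts at a bottom point whose strand points upwards or at a top point whose
  strand points downwards, and ends at one of the other boundary points.\<close>

definition bounded_by :: "strand list \<Rightarrow> strand list \<Rightarrow> tangle_diagram \<Rightarrow> bool" where
  "bounded_by ss ts D \<longleftrightarrow>
     ported (strand_ports Bot True ss + strand_ports Top False ts)
            (strand_ports Bot False ss + strand_ports Top True ts) D"

lemma bounded_by_erase: "bounded_by ss ts (erase D) \<longleftrightarrow> bounded_by ss ts D"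
  by (simp add: bounded_by_def ported_erase)

lemma ported_map_diagram:
  assumes "ported P Q D"
  shows "ported (image_mset (map_prod \<pi> id) P) (image_mset (map_prod \<pi> id) Q) (map_diagram \<pi> f D)"
  using assms
  by (auto simp: ported_def map_diagram_def source_of_def[abs_def] target_of_def[abs_def] multiset.map_comp comp_def)

lemma ported_disjoint_union:
  assumes "ported P Q D" "ported P' Q' E"
  shows "ported (P + P') (Q + Q') (disjoint_union D E)"
proof -
  have "image_mset (map_prod id id) P = P" for P :: "(port \<times> nat) multiset"
    by (simp add: prod.map_id0)
  with ported_map_diagram[OF assms(1), of id] ported_map_diagram[OF assms(2), of id] show ?thesis
    by (auto simp: ported_def disjoint_union_def Let_def)
qed

lemma stack_properties:
  assumes D: "bounded_by ss ts D" and E: "bounded_by ts us E"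
  shows "bounded_by ss us (stack (length ts) D E)"
    and "erase (stack (length ts) D E) = stack (length ts) (erase D) (erase E)"
    and "chord_types (stack (length ts) D E) = chord_types D + chord_types E"
    and "balanced (ends D) \<Longrightarrow> balanced (ends E) \<Longrightarrow> balanced (ends (stack (length ts) D E))"
proof -
  define U where "U D E = disjoint_union (map_diagram top_to_mid id D) (map_diagram bot_to_mid id E)" for D E
  define M where "M = mset (map (\<lambda>i. (Mid i, snd (ts ! i))) [0..<length ts])"
  define P where "P = strand_ports Bot True ss + strand_ports Top False us"
  define Q where "Q = strand_ports Bot False ss + strand_ports Top True us"
  \<comment> \<open>At each middle point one of the two diagrams has a target and the other a
    source; which of them depends on the orientation. Taken together, all of \<open>M\<close> occurs
    among the sources and all of it among the targets.\<close>
  have Ms: "M = strand_ports Mid True ts + strand_ports Mid False ts"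
    using strand_ports_both[of Mid True ts] by (simp add: M_def)
  have sP: "simple_ports (P + M)" and sQ: "simple_ports (Q + M)"
    unfolding P_def Q_def M_def by (rule simple_boundary_ports)+
  have p: "ported (P + M) (Q + M) (U D E)"
  proof -
    note d = ported_map_diagram[OF D[unfolded bounded_by_def], of top_to_mid id]
    note e = ported_map_diagram[OF E[unfolded bounded_by_def], of bot_to_mid id]
    from ported_disjoint_union[OF d e] show ?thesis
      unfolding U_def P_def Q_def Ms by (simp add: image_strand_ports ac_simps)
  qed
  from fold_glue[OF p[unfolded M_def] sP[unfolded M_def] sQ[unfolded M_def]]
  have f: "ported P Q (stack (length ts) D E)" "ends (stack (length ts) D E) = ends (U D E)"
    "erase (stack (length ts) D E) = fold glue [0..<length ts] (erase (U D E))"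
    by (simp_all add: stack_def U_def)
  show "bounded_by ss us (stack (length ts) D E)"
    using f(1) by (simp add: bounded_by_def P_def Q_def)
  have e: "ends (map_diagram \<pi> id D) = ends D" for \<pi> D
    by (simp add: ends_map_diagram prod.map_id0)
  show "erase (stack (length ts) D E) = stack (length ts) (erase D) (erase E)"
    unfolding f(3) by (simp add: stack_def U_def erase_disjoint_union erase_map_diagram[where g = id])
  have c: "chord_types (map_diagram \<pi> id D) = chord_types D" for \<pi> D
    by (simp add: chord_types_def e)
  show "chord_types (stack (length ts) D E) = chord_types D + chord_types E"
    using disjoint_union_chords(1) unfolding chord_types_def f(2) U_def
    by (simp add: c flip: chord_types_def)
  show "balanced (ends (stack (length ts) D E))" if "balanced (ends D)" "balanced (ends E)"
    using disjoint_union_chords(2) that unfolding f(2) U_def by (simp add: e)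
qed

lemma beside_properties:
  assumes D: "bounded_by ss ts D" and E: "bounded_by us vs E"
  shows "bounded_by (ss @ us) (ts @ vs) (beside (length ss) (length ts) D E)"
    and "erase (beside b t D E) = beside b t (erase D) (erase E)"
    and "chord_types (beside b t D E) = chord_types D + chord_types E"
    and "balanced (ends D) \<Longrightarrow> balanced (ends E) \<Longrightarrow> balanced (ends (beside b t D E))"
proof -
  have e: "ends (map_diagram \<pi> id D) = ends D" for \<pi> D
    by (simp add: ends_map_diagram prod.map_id0)
  show "bounded_by (ss @ us) (ts @ vs) (beside (length ss) (length ts) D E)"
    using ported_disjoint_union[OF D[unfolded bounded_by_def]
      ported_map_diagram[OF E[unfolded bounded_by_def], of "shift_port (length ss) (length ts)" id]]
    by (simp add: bounded_by_def beside_def strand_ports_append image_strand_ports ac_simps)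
  show "erase (beside b t D E) = beside b t (erase D) (erase E)"
    by (simp add: beside_def erase_disjoint_union erase_map_diagram[where g = id])
  show "chord_types (beside b t D E) = chord_types D + chord_types E"
    by (simp add: beside_def disjoint_union_chords) (simp add: chord_types_def e)
  show "balanced (ends (beside b t D E))" if "balanced (ends D)" "balanced (ends E)"
    using disjoint_union_chords(2) that unfolding beside_def by (simp add: e)
qed

section \<open>Ports of the elementary diagrams\<close>

lemma erase_trivial_diagram: "erase (trivial_diagram ss ws) = trivial_diagram ss (map (\<lambda>_. []) ss)"
  by (simp add: erase_def trivial_diagram_def oriented_arc_def)

lemma ends_oriented_arc: "ends_on (arc_comp (oriented_arc b x y c w)) (arc_word (oriented_arc b x y c w)) = ends_on c w"
  by (simp add: oriented_arc_def)

lemma ends_trivial_diagram: "ends (trivial_diagram ss ws) = (\<Sum>j<length ss. ends_on (snd (ss ! j)) (ws ! j))"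
  by (simp add: ends_def trivial_diagram_def comp_def ends_oriented_arc interv_sum_list_conv_sum_set_nat lessThan_atLeast0)

lemma bounded_trivial_diagram: "bounded_by ss ss (trivial_diagram ss ws)"
proof -
  have s: "source_of \<circ> (\<lambda>j. oriented_arc (fst (ss ! j)) (Bot j) (Top j) (snd (ss ! j)) (ws ! j)) =
      (\<lambda>j. if fst (ss ! j) then (Bot j, snd (ss ! j)) else (Top j, snd (ss ! j)))"
    by (auto simp: source_of_def oriented_arc_def fun_eq_iff)
  have t: "target_of \<circ> (\<lambda>j. oriented_arc (fst (ss ! j)) (Bot j) (Top j) (snd (ss ! j)) (ws ! j)) =
      (\<lambda>j. if fst (ss ! j) then (Top j, snd (ss ! j)) else (Bot j, snd (ss ! j)))"
    by (auto simp: target_of_def oriented_arc_def fun_eq_iff)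
  show ?thesis
    unfolding bounded_by_def ported_def trivial_diagram_def fst_conv mset_map[symmetric] map_map s t mset_map_if
    by (simp add: strand_ports_def)
qed

lemma strand_ports_Cons_simps:
  "strand_ports f b [s] = (if fst s = b then {#(f 0, snd s)#} else {#})"
  "strand_ports f b [s, t] = (if fst s = b then {#(f 0, snd s)#} else {#}) + (if fst t = b then {#(f 1, snd t)#} else {#})"
  by (auto simp: strand_ports_def upt_rec)

lemma bounded_cross_diagram: "bounded_by [s, t] [t, s] (cross_diagram s t v w)"
  by (auto simp: bounded_by_def ported_def cross_diagram_def oriented_arc_def strand_ports_Cons_simps
    source_of_def target_of_def)

lemma bounded_cap_diagram: "bounded_by [s, reversed s] [] (cap_diagram s w)"
  by (auto simp: bounded_by_def ported_def cap_diagram_def oriented_arc_def strand_ports_Cons_simps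
    source_of_def target_of_def reversed_def)

lemma bounded_cup_diagram: "bounded_by [] [s, reversed s] (cup_diagram s w)"
  by (auto simp: bounded_by_def ported_def cup_diagram_def oriented_arc_def strand_ports_Cons_simps
    source_of_def target_of_def reversed_def)

lemma points_qpair [simp]: "points (qpair u v) = points u @ points v"
  by (induction u v rule: qpair.induct) auto

lemma skeleton_bounded:
  assumes "composable A"
  shows "bounded_by (points (bottom_word A)) (points (top_word A)) (skeleton A) \<and> erase (skeleton A) = skeleton A"
  using assms
proof (induction A)
  case (Comp A B)
  then show ?case
    using stack_properties(1,2)[of "points (bottom_word A)" "points (top_word A)" "skeleton A"
      "points (top_word B)" "skeleton B"] by simp
next
  case (Juxt A B)
  then show ?case
    using beside_properties(1,2)[of "points (bottom_word A)" "points (top_word A)" "skeleton A"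
      "points (bottom_word B)" "points (top_word B)" "skeleton B"] by simp
next
  case (Trivial s)
  then show ?case by (simp add: bounded_trivial_diagram erase_trivial_diagram)
next
  case (Assoc u v w)
  then show ?case
    by (simp add: Let_def bounded_trivial_diagram erase_trivial_diagram flip: map_append append_assoc)
next
  case (AssocInv u v w)
  then show ?case
    by (simp add: Let_def bounded_trivial_diagram erase_trivial_diagram flip: map_append append_assoc)
next
  case (Cross e s t)
  then show ?case
    by (simp add: bounded_cross_diagram) (simp add: cross_diagram_def erase_def oriented_arc_def)
next
  case (Cap s)
  then show ?case
    by (simp add: bounded_cap_diagram) (simp add: cap_diagram_def erase_def oriented_arc_def)
next
  case (Cup s)
  then show ?case
    by (simp add: bounded_cup_diagram) (simp add: cup_diagram_def erase_def oriented_arc_def)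
qed

section \<open>The image of Z in the type ring\<close>

definition has_shape :: "qtangle \<Rightarrow> nat \<Rightarrow> tangle_diagram \<Rightarrow> bool" where
  "has_shape A n E \<longleftrightarrow> erase E = skeleton A \<and> balanced (ends E) \<and> size (chord_types E) = n"

lemma has_shape_bounded:
  "composable A \<Longrightarrow> has_shape A n E \<Longrightarrow> bounded_by (points (bottom_word A)) (points (top_word A)) E"
  using skeleton_bounded[of A] bounded_by_erase[of _ _ E] by (simp add: has_shape_def)

definition weight :: "tangle_diagram \<Rightarrow> type_ring" where
  "weight E = Poly_Mapping.single (chord_types E) 1"

abbreviation type_var :: "nat multiset \<Rightarrow> type_ring" where
  "type_var p \<equiv> Poly_Mapping.single {#p#} 1"

text \<open>The logarithm of the image of Z; \<open>e\<close> is the sign of the oriented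
  crossing.\<close>

definition crossing_sum :: "qtangle \<Rightarrow> type_ring" where
  "crossing_sum A = (\<Sum>(e, c, d)\<leftarrow>crossings A. scalar (of_int e / 2) * type_var {#c, d#})"

lemma single_sum_mset: "Poly_Mapping.single (\<Sum>k\<in>A. M k) (1::rat) = (\<Prod>k\<in>A. Poly_Mapping.single (M k) 1)"
proof (induction A rule: infinite_finite_induct)
  case (insert x F)
  then show ?case by (simp add: mult_single flip: insert.IH)
qed auto

lemma ends_cross_diagram:
  "ends (cross_diagram s t [0..<n] [0..<n]) = (\<Sum>k<n. {#(k, snd s), (k, snd t)#})"
proof -
  have "ends (cross_diagram s t [0..<n] [0..<n]) = ends_on (snd s) [0..<n] + ends_on (snd t) [0..<n]"
    by (simp add: ends_def cross_diagram_def ends_oriented_arc)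
  also have "\<dots> = (\<Sum>k<n. {#(k, snd s), (k, snd t)#})"
    by (induction n) (auto simp: ends_on_append, simp add: ends_on_def)
  finally show ?thesis .
qed

lemma chord_types_cross_diagram:
  "chord_types (cross_diagram s t [0..<n] [0..<n]) = (\<Sum>k<n. {#{#snd s, snd t#}#})"
  "balanced (ends (cross_diagram s t [0..<n] [0..<n]))"
  unfolding chord_types_def ends_cross_diagram using types_chords[of "\<lambda>_. snd s" "\<lambda>_. snd t"] by auto

lemma size_sum_singleton: "size (\<Sum>k<n. {#M k#}) = n"
  by (induction n) auto

text \<open>Both strands carry \<open>n\<close> ends, so each downward strand contributes (-1)^n.
  Together with the sign of \<open>X\<^sub>\<plusminus>\<close> this is the \<open>n\<close>-th
  power of the sign that \<open>crossings\<close> lists.\<close>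

lemma ev_Z_cross: "ev weight (Z \<Phi> (Cross e s t) n) = Exp (crossing_sum (Cross e s t)) n"
proof -
  let ?\<epsilon> = "(if e then 1 else - 1) * (if fst s = fst t then 1 else - 1) :: rat"
  have "reversal_sign (fst s) [0..<n] * reversal_sign (fst t) [0..<n] = (if fst s = fst t then 1 else - 1) ^ n"
    by (auto simp: reversal_sign_def simp flip: power_mult_distrib)
  then have "(if e then 1 else - 1) ^ n / (2 ^ n * fact n) * reversal_sign (fst s) [0..<n] * reversal_sign (fst t) [0..<n] =
      1 / fact n * (?\<epsilon> / 2) ^ n"
    by (simp only: mult.assoc power_divide power_mult_distrib) (simp add: field_simps)
  then have "ev weight (Z \<Phi> (Cross e s t) n) = scalar (1 / fact n * (?\<epsilon> / 2) ^ n) * (\<Prod>k<n. type_var {#snd s, snd t#})"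
    by (simp only: Z.simps Z_cross_def ev_single weight_def chord_types_cross_diagram single_sum_mset)
  moreover have "scalar (c ^ n) = scalar c ^ n" for c
    by (induction n) (simp_all add: scalar_mult)
  moreover have "of_int ((if e then 1 else - 1) * (if fst s = fst t then 1 else - 1)) = ?\<epsilon>"
    by simp
  ultimately show ?thesis
    by (simp only: Exp_def crossing_sum_def crossings.simps list.map sum_list.Cons sum_list.Nil case_prod_conv
      add_0_right scalar_mult power_mult_distrib prod_constant card_lessThan mult.assoc)
qed

text \<open>All chords of a word placed on one component have the same type, so the length of the
  word determines the types.\<close>

lemma chord_types_constant:
  assumes "chord_word w" "length w = 2 * n"
  shows "types (ends_on c w) = replicate_mset n {#c, c#}" "balanced (ends_on c w)"
proof -
  have f: "fst ` set_mset (ends_on c w) = set w"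
    by (auto simp: ends_on_def image_image)
  have "length w = (\<Sum>x\<in>set w. count_list w x)"
    by (simp add: sum_count_set)
  also have "\<dots> = 2 * card (set w)"
    using assms(1) by (simp add: chord_word_def)
  finally have n: "card (set w) = n" using assms(2) by simp
  have "types (ends_on c w) = image_mset (\<lambda>_. {#c, c#}) (mset_set (set w))"
    unfolding types_def f partners_ends_on using assms(1)
    by (intro image_mset_cong) (simp add: chord_word_def numeral_2_eq_2)
  then show "types (ends_on c w) = replicate_mset n {#c, c#}"
    by (simp add: n image_mset_const_eq)
  show "balanced (ends_on c w)"
    unfolding balanced_def f partners_ends_on using assms(1) by (simp add: chord_word_def)
qed

lemma cap_cup_properties:
  assumes "chord_word w" "length w = 2 * n"
  shows "has_shape (Cap s) n (cap_diagram s w)" "has_shape (Cup s) n (cup_diagram s w)"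
    "chord_types (cap_diagram s w) = replicate_mset n {#snd s, snd s#}"
    "chord_types (cup_diagram s w) = replicate_mset n {#snd s, snd s#}"
proof -
  have e: "ends (cap_diagram s w) = ends_on (snd s) w" "ends (cup_diagram s w) = ends_on (snd s) w"
    by (simp_all add: ends_def cap_diagram_def cup_diagram_def ends_oriented_arc)
  show *: "chord_types (cap_diagram s w) = replicate_mset n {#snd s, snd s#}"
    "chord_types (cup_diagram s w) = replicate_mset n {#snd s, snd s#}"
    using chord_types_constant[OF assms] by (simp_all add: chord_types_def e)
  show "has_shape (Cap s) n (cap_diagram s w)" "has_shape (Cup s) n (cup_diagram s w)"
    using chord_types_constant(2)[OF assms] * unfolding has_shape_def
    by (simp_all add: e) (simp_all add: cap_diagram_def cup_diagram_def erase_def oriented_arc_def)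
qed

text \<open>The words of degree \<open>n\<close> have even length \<open>2 * n\<close>, so the
  reversal sign is 1, and they all have the same monomial. Factoring it out leaves the sum of the
  coefficients of \<open>sqrt_nu n\<close>.\<close>

lemma ev_Z_cap_cup:
  "ev weight (Z \<Phi> (Cap s) n) = (if n = 0 then 1 else 0)"
  "ev weight (Z \<Phi> (Cup s) n) = (if n = 0 then 1 else 0)"
proof -
  have *: "(\<Sum>w\<in>Poly_Mapping.keys (sqrt_nu n). scalar (Poly_Mapping.lookup (sqrt_nu n) w) *
      ev weight (Poly_Mapping.single (g w) (reversal_sign b w))) = (if n = 0 then 1 else 0)"
    if g: "\<And>w. chord_word w \<Longrightarrow> length w = 2 * n \<Longrightarrow> chord_types (g w) = replicate_mset n p" for g b p
  proof -
    have "(\<Sum>w\<in>Poly_Mapping.keys (sqrt_nu n). scalar (Poly_Mapping.lookup (sqrt_nu n) w) *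
        ev weight (Poly_Mapping.single (g w) (reversal_sign b w))) =
      (\<Sum>w\<in>Poly_Mapping.keys (sqrt_nu n). scalar (Poly_Mapping.lookup (sqrt_nu n) w) * 1 *
        Poly_Mapping.single (replicate_mset n p) 1)"
      by (rule sum.cong) (use keys_sqrt_nu g in \<open>auto simp: weight_def reversal_sign_def\<close>)
    also have "\<dots> = ev (\<lambda>_. 1) (sqrt_nu n) * Poly_Mapping.single (replicate_mset n p) 1"
      unfolding ev_def sum_distrib_right ..
    also have "\<dots> = (if n = 0 then 1 else 0)"
      by (simp add: ev_sqrt_nu)
    finally show ?thesis .
  qed
  show "ev weight (Z \<Phi> (Cap s) n) = (if n = 0 then 1 else 0)"
    "ev weight (Z \<Phi> (Cup s) n) = (if n = 0 then 1 else 0)"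
    using cap_cup_properties(3,4) by (simp_all only: Z.simps ev_lin_ext *)
qed

lemma finite_tgens [simp]: "finite (tgens n)"
  by (rule finite_subset[of _ "{..<n} \<times> {..<n}"]) (auto simp: tgens_def)

lemma mset_strand_word:
  "mset (strand_word h j) = (\<Sum>k<length h. if j = fst (h ! k) \<or> j = snd (h ! k) then {#k#} else {#})"
proof -
  have "mset (filter Q [0..<n]) = (\<Sum>k<n. if Q k then {#k#} else {#})" for Q and n :: nat
    by (induction n) auto
  then show ?thesis by (simp add: strand_word_def)
qed

text \<open>Double counting: the ends are collected along the strands on the left and chord by chord
  on the right. A letter of \<open>tgens\<close> joins two different strands, so each chord
  contributes exactly two ends.\<close>

lemma ends_strand_words:
  assumes "set h \<subseteq> tgens (length ss)"
  shows "ends (trivial_diagram ss (map (strand_word h) [0..<length ss])) =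
    (\<Sum>k<length h. {#(k, snd (ss ! fst (h ! k))), (k, snd (ss ! snd (h ! k)))#})"
proof -
  have "ends (trivial_diagram ss (map (strand_word h) [0..<length ss])) =
     (\<Sum>j<length ss. \<Sum>k<length h. if j = fst (h ! k) \<or> j = snd (h ! k) then {#(k, snd (ss ! j))#} else {#})"
    unfolding ends_trivial_diagram
    by (intro sum.cong refl) (auto simp: ends_on_def mset_strand_word image_mset_sum intro!: sum.cong)
  also have "\<dots> = (\<Sum>k<length h. \<Sum>j<length ss. if j = fst (h ! k) \<or> j = snd (h ! k) then {#(k, snd (ss ! j))#} else {#})"
    by (rule sum.swap)
  also have "\<dots> = (\<Sum>k<length h. {#(k, snd (ss ! fst (h ! k))), (k, snd (ss ! snd (h ! k)))#})"
  proof (rule sum.cong [OF refl])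
    fix k assume "k \<in> {..<length h}"
    then have "h ! k \<in> tgens (length ss)" using assms by auto
    then have ab: "fst (h ! k) < length ss" "snd (h ! k) < length ss" "fst (h ! k) \<noteq> snd (h ! k)"
      by (auto simp: tgens_def)
    have "(\<Sum>j<length ss. if j = fst (h ! k) \<or> j = snd (h ! k) then {#(k, snd (ss ! j))#} else {#}) =
        (\<Sum>j<length ss. (if j = fst (h ! k) then {#(k, snd (ss ! j))#} else {#}) +
          (if j = snd (h ! k) then {#(k, snd (ss ! j))#} else {#}))"
      using ab(3) by (intro sum.cong refl) auto
    also have "\<dots> = {#(k, snd (ss ! fst (h ! k))), (k, snd (ss ! snd (h ! k)))#}"
      using ab by (simp add: sum.distrib)
    finally show "(\<Sum>j<length ss. if j = fst (h ! k) \<or> j = snd (h ! k) then {#(k, snd (ss ! j))#} else {#}) =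
      {#(k, snd (ss ! fst (h ! k))), (k, snd (ss ! snd (h ! k)))#}" .
  qed
  finally show ?thesis .
qed

text \<open>The same exchange of strands and chords, for signs: each chord receives the product of
  the signs of the two strands that it joins. The total sign is thus multiplicative in the letters
  of \<open>h\<close>.\<close>

lemma prod_reversal_sign:
  assumes "set h \<subseteq> tgens n"
  shows "(\<Prod>j<n. reversal_sign (up j) (strand_word h j)) =
    (\<Prod>k<length h. (if up (fst (h ! k)) then 1 else - 1) * (if up (snd (h ! k)) then 1 else - 1))"
proof -
  define s where "s j = (if up j then 1 else - 1 :: rat)" for j
  have len: "length (strand_word h j) = (\<Sum>k<length h. if j = fst (h ! k) \<or> j = snd (h ! k) then 1 else 0)" for j
  proof -
    have "size (mset (strand_word h j)) = (\<Sum>k<length h. size (if j = fst (h ! k) \<or> j = snd (h ! k) then {#k#} else {#}))"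
      unfolding mset_strand_word by (simp add: size_multiset_sum)
    also have "\<dots> = (\<Sum>k<length h. if j = fst (h ! k) \<or> j = snd (h ! k) then 1 else 0)"
      by (intro sum.cong) auto
    finally show ?thesis by simp
  qed
  have "(\<Prod>j<n. reversal_sign (up j) (strand_word h j)) = (\<Prod>j<n. s j ^ length (strand_word h j))"
    by (intro prod.cong) (auto simp: reversal_sign_def s_def)
  also have "\<dots> = (\<Prod>j<n. \<Prod>k<length h. if j = fst (h ! k) \<or> j = snd (h ! k) then s j else 1)"
    unfolding len power_sum by (intro prod.cong) auto
  also have "\<dots> = (\<Prod>k<length h. \<Prod>j<n. if j = fst (h ! k) \<or> j = snd (h ! k) then s j else 1)"
    by (rule prod.swap)
  also have "\<dots> = (\<Prod>k<length h. s (fst (h ! k)) * s (snd (h ! k)))"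
  proof (rule prod.cong [OF refl])
    fix k assume "k \<in> {..<length h}"
    then have "h ! k \<in> tgens n" using assms by auto
    then have ab: "fst (h ! k) < n" "snd (h ! k) < n" "fst (h ! k) \<noteq> snd (h ! k)"
      by (auto simp: tgens_def)
    have "(\<Prod>j<n. if j = fst (h ! k) \<or> j = snd (h ! k) then s j else 1) =
        (\<Prod>j<n. (if j = fst (h ! k) then s j else 1) * (if j = snd (h ! k) then s j else 1))"
      using ab(3) by (intro prod.cong refl) auto
    also have "\<dots> = s (fst (h ! k)) * s (snd (h ! k))"
      using ab by (simp add: prod.distrib)
    finally show "(\<Prod>j<n. if j = fst (h ! k) \<or> j = snd (h ! k) then s j else 1) = s (fst (h ! k)) * s (snd (h ! k))" .
  qed
  finally show ?thesis by (simp add: s_def)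
qed

lemma chord_types_strand_words:
  assumes "set h \<subseteq> tgens (length ss)"
  shows "chord_types (trivial_diagram ss (map (strand_word h) [0..<length ss])) =
      (\<Sum>k<length h. {#{#snd (ss ! fst (h ! k)), snd (ss ! snd (h ! k))#}#})"
    and "balanced (ends (trivial_diagram ss (map (strand_word h) [0..<length ss])))"
  unfolding chord_types_def ends_strand_words[OF assms]
  using types_chords[of "\<lambda>k. snd (ss ! fst (h ! k))" "\<lambda>k. snd (ss ! snd (h ! k))"] by auto

lemma ev_Z_horizontal:
  assumes "\<And>Y. cev Y f n = (if n = 0 then 1 else 0)"
  shows "ev weight (Z_horizontal ss (nc_subst f x) n) = (if n = 0 then 1 else 0)"
proof -
  \<comment> \<open>The value of one horizontal chord: its type, with the orientation signs of its
    two strands absorbed into the coefficient.\<close>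
  define V where "V g = scalar ((if fst (ss ! fst g) then 1 else - 1) * (if fst (ss ! snd g) then 1 else - 1)) *
    type_var {#snd (ss ! fst g), snd (ss ! snd g)#}" for g
  have "ev weight (Z_horizontal ss (nc_subst f x) n) =
    (\<Sum>h | length h = n \<and> set h \<subseteq> tgens (length ss). scalar (nc_subst f x h) * (\<Prod>k<n. V (h ! k)))"
    unfolding Z_horizontal_def ev_sum
  proof (rule sum.cong [OF refl])
    fix h assume "h \<in> {h. length h = n \<and> set h \<subseteq> tgens (length ss)}"
    then have h: "length h = n" "set h \<subseteq> tgens (length ss)" by auto
    show "ev weight (Poly_Mapping.single (trivial_diagram ss (map (strand_word h) [0..<length ss]))
         (nc_subst f x h * (\<Prod>j<length ss. reversal_sign (fst (ss ! j)) (strand_word h j)))) =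
       scalar (nc_subst f x h) * (\<Prod>k<n. V (h ! k))"
      using h(1)
      by (simp only: ev_single weight_def chord_types_strand_words(1)[OF h(2)] single_sum_mset
        prod_reversal_sign[OF h(2)] scalar_mult scalar_prod V_def prod.distrib mult.assoc)
  qed
  also have "\<dots> = (if n = 0 then 1 else 0)"
    unfolding sum_subst_eq_cev[OF finite_tgens] by (rule assms)
  finally show ?thesis .
qed

lemma keys_Z_horizontal:
  assumes "E \<in> Poly_Mapping.keys (Z_horizontal ss f n)"
  shows "erase E = trivial_diagram ss (map (\<lambda>_. []) ss) \<and> balanced (ends E) \<and> size (chord_types E) = n"
proof -
  obtain h where h: "length h = n" "set h \<subseteq> tgens (length ss)"
    and E: "E = trivial_diagram ss (map (strand_word h) [0..<length ss])"
    using assms unfolding Z_horizontal_def by (fastforce dest!: keys_sum_subset[THEN subsetD] split: if_splits)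
  show ?thesis
    using chord_types_strand_words[OF h(2)] h(1) by (simp add: E erase_trivial_diagram size_sum_singleton)
qed

text \<open>This supplies the ports needed for multiplicativity under \<open>stack\<close> and
  \<open>beside\<close> and, for links, the list of circles and the degree of each diagram.\<close>

lemma keys_Z:
  assumes "composable A" "E \<in> Poly_Mapping.keys (Z \<Phi> A n)"
  shows "has_shape A n E"
  using assms
proof (induction A arbitrary: n E)
  case (Trivial s)
  then show ?case
    by (auto simp: series_unit_def has_shape_def erase_trivial_diagram ends_trivial_diagram chord_types_def split: if_splits)
next
  case (Cross e s t)
  then have E: "E = cross_diagram s t [0..<n] [0..<n]"
    by (auto simp: Z_cross_def split: if_splits)
  show ?case
    using chord_types_cross_diagram[of s t n] unfolding has_shape_def E
    by (simp add: size_sum_singleton) (simp add: cross_diagram_def erase_def oriented_arc_def)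
next
  case (Cap s)
  then obtain w where "w \<in> Poly_Mapping.keys (sqrt_nu n)" "E = cap_diagram s w"
    using keys_lin_ext[of _ "sqrt_nu n"] by (fastforce split: if_splits)
  then show ?case using keys_sqrt_nu cap_cup_properties(1) by blast
next
  case (Cup s)
  then obtain w where "w \<in> Poly_Mapping.keys (sqrt_nu n)" "E = cup_diagram s w"
    using keys_lin_ext[of _ "sqrt_nu n"] by (fastforce split: if_splits)
  then show ?case using keys_sqrt_nu cap_cup_properties(2) by blast
next
  case (Assoc u v w)
  then show ?case by (simp add: Z_assoc_def Let_def has_shape_def keys_Z_horizontal)
next
  case (AssocInv u v w)
  then show ?case by (simp add: Z_assoc_def Let_def has_shape_def keys_Z_horizontal)
next
  case (Comp A B)
  from Comp.prems obtain k X Y where kXY: "k \<le> n" "X \<in> Poly_Mapping.keys (Z \<Phi> A k)"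
    "Y \<in> Poly_Mapping.keys (Z \<Phi> B (n - k))" "E = stack (length (points (top_word A))) X Y"
    by (auto elim: keys_series_prodE)
  then have X: "has_shape A k X" and Y: "has_shape B (n - k) Y"
    using Comp by auto
  from Comp.prems X Y have b: "bounded_by (points (bottom_word A)) (points (top_word A)) X"
    "bounded_by (points (top_word A)) (points (top_word B)) Y"
    using has_shape_bounded[of A k X] has_shape_bounded[of B "n - k" Y] by auto
  show ?case
    using X Y kXY(1) stack_properties(2-4)[OF b] by (simp add: has_shape_def kXY(4))
next
  case (Juxt A B)
  from Juxt.prems obtain k X Y where kXY: "k \<le> n" "X \<in> Poly_Mapping.keys (Z \<Phi> A k)"
    "Y \<in> Poly_Mapping.keys (Z \<Phi> B (n - k))"
    "E = beside (length (points (bottom_word A))) (length (points (top_word A))) X Y"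
    by (auto elim: keys_series_prodE)
  then have X: "has_shape A k X" and Y: "has_shape B (n - k) Y"
    using Juxt by auto
  from Juxt.prems have b: "bounded_by (points (bottom_word A)) (points (top_word A)) X"
    "bounded_by (points (bottom_word B)) (points (top_word B)) Y"
    using has_shape_bounded[OF _ X] has_shape_bounded[OF _ Y] by auto
  show ?case
    using X Y kXY(1) beside_properties(2-4)[OF b] by (simp add: has_shape_def kXY(4))
qed

lemma crossing_sum_simps:
  "crossing_sum (Comp A B) = crossing_sum A + crossing_sum B"
  "crossing_sum (Juxt A B) = crossing_sum A + crossing_sum B"
  "crossing_sum (Trivial s) = 0" "crossing_sum (Cap s) = 0" "crossing_sum (Cup s) = 0"
  "crossing_sum (Assoc u v w) = 0" "crossing_sum (AssocInv u v w) = 0"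
  by (simp_all add: crossing_sum_def)

lemma ev_Z:
  assumes "drinfeld_associator \<Phi>" "composable A"
  shows "ev weight (Z \<Phi> A n) = Exp (crossing_sum A) n"
  using assms(2)
proof (induction A arbitrary: n)
  case (Trivial s)
  show ?case
    by (simp add: ev_series_unit crossing_sum_simps weight_def chord_types_def ends_trivial_diagram)
next
  case (Cross e s t)
  show ?case by (rule ev_Z_cross)
next
  case (Cap s)
  show ?case by (simp only: ev_Z_cap_cup crossing_sum_simps Exp_0)
next
  case (Cup s)
  show ?case by (simp only: ev_Z_cap_cup crossing_sum_simps Exp_0)
next
  case (Assoc u v w)
  show ?case
    by (simp add: Z_assoc_def Let_def on_bundles_def ev_Z_horizontal cev_associator[OF assms(1)] crossing_sum_simps)
next
  case (AssocInv u v w)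
  show ?case
    by (simp add: Z_assoc_def Let_def on_bundles_def ev_Z_horizontal cev_associator[OF assms(1)] crossing_sum_simps)
next
  case (Comp A B)
  have "weight (stack (length (points (top_word A))) X Y) = weight X * weight Y"
    if "X \<in> Poly_Mapping.keys (Z \<Phi> A k)" "Y \<in> Poly_Mapping.keys (Z \<Phi> B l)" for k l X Y
  proof -
    have b: "bounded_by (points (bottom_word A)) (points (top_word A)) X"
      "bounded_by (points (top_word A)) (points (top_word B)) Y"
      using has_shape_bounded[OF _ keys_Z[OF _ that(1)]] has_shape_bounded[OF _ keys_Z[OF _ that(2)]] Comp.prems
      by auto
    show ?thesis using stack_properties(3)[OF b] by (simp add: weight_def mult_single)
  qed
  then show ?case
    using Comp by (simp add: ev_series_prod[where u = weight and v = weight] crossing_sum_simps Exp_add)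
next
  case (Juxt A B)
  have "weight (beside (length (points (bottom_word A))) (length (points (top_word A))) X Y) = weight X * weight Y"
    if "X \<in> Poly_Mapping.keys (Z \<Phi> A k)" "Y \<in> Poly_Mapping.keys (Z \<Phi> B l)" for k l X Y
  proof -
    have b: "bounded_by (points (bottom_word A)) (points (top_word A)) X"
      "bounded_by (points (bottom_word B)) (points (top_word B)) Y"
      using has_shape_bounded[OF _ keys_Z[OF _ that(1)]] has_shape_bounded[OF _ keys_Z[OF _ that(2)]] Juxt.prems
      by auto
    show ?thesis using beside_properties(3)[OF b] by (simp add: weight_def mult_single)
  qed
  then show ?case
    using Juxt by (simp add: ev_series_prod[where u = weight and v = weight] crossing_sum_simps Exp_add)
qed

section \<open>Chord diagrams on circles\<close>

text \<open>Circles are numbered from 1 and list positions from 0, hence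
  \<open>Suc i\<close>.\<close>

definition word_ends :: "nat list list \<Rightarrow> (nat \<times> nat) multiset" where
  "word_ends ws = (\<Sum>i<length ws. ends_on (Suc i) (ws ! i))"

lemma size_partners: "size (partners K x) = count (image_mset fst K) x"
  unfolding partners_def by (induction K) auto

lemma word_ends_snoc: "word_ends (ws @ [w]) = word_ends ws + ends_on (Suc (length ws)) w"
  by (simp add: word_ends_def nth_append cong: sum.cong_simp)

lemma image_fst_word_ends: "image_mset fst (word_ends ws) = mset (concat ws)"
  by (induction ws rule: rev_induct)
    (auto simp: word_ends_snoc, auto simp: word_ends_def ends_on_def multiset.map_comp comp_def)

lemma labels_word_ends: "fst ` set_mset (word_ends ws) = set (concat ws)"
  using arg_cong[OF image_fst_word_ends[of ws], of set_mset] by simp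

lemma chord_words_iff: "ws \<in> chord_words m \<longleftrightarrow> length ws = m \<and> balanced (word_ends ws)"
  unfolding chord_words_def balanced_def labels_word_ends
  by (simp add: size_partners image_fst_word_ends count_mset del: set_concat)

lemma mset_rotate: "mset (rotate k xs) = mset xs"
proof -
  have "mset (rotate1 xs) = mset xs" for xs :: "'a list" by (cases xs) auto
  then show ?thesis by (induction k) auto
qed

lemma diagram_iso_word_ends:
  assumes "(ws, ws') \<in> diagram_iso m"
  obtains f where "inj_on f (set (concat ws))" "word_ends ws' = image_mset (map_prod f id) (word_ends ws)"
proof -
  from assms obtain f where f: "inj_on f (set (concat ws))"
    and r: "\<And>i. i < m \<Longrightarrow> \<exists>k. ws' ! i = rotate k (map f (ws ! i))"
    and l: "length ws = m" "length ws' = m"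
    unfolding diagram_iso_def chord_words_def by auto
  have "ends_on (Suc i) (ws' ! i) = image_mset (map_prod f id) (ends_on (Suc i) (ws ! i))" if "i < m" for i
  proof -
    from r[OF that] obtain k where "ws' ! i = rotate k (map f (ws ! i))" ..
    then show ?thesis unfolding ends_on_map[symmetric] by (simp add: ends_on_def mset_rotate)
  qed
  then have "word_ends ws' = image_mset (map_prod f id) (word_ends ws)"
    by (simp add: word_ends_def image_mset_sum l)
  with f that show thesis by blast
qed

lemma diagram_iso_types:
  assumes "(ws, ws') \<in> diagram_iso m"
  shows "types (word_ends ws') = types (word_ends ws)"
  using assms by (rule diagram_iso_word_ends) (simp only: types_relabel labels_word_ends)

text \<open>Rotations preserve the multiset of letters, so the ends of \<open>ws'\<close> are those
  of \<open>ws\<close> relabelled; \<open>ws'\<close> is then itself a chord word by invariance of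
  \<open>balanced\<close>.\<close>

lemma diagram_iso_relabel:
  assumes "ws \<in> chord_words m" "inj_on f (set (concat ws))" "length ws' = m"
    and "\<And>i. i < m \<Longrightarrow> \<exists>k. ws' ! i = rotate k (map f (ws ! i))"
  shows "(ws, ws') \<in> diagram_iso m"
proof -
  have l: "length ws = m" using assms(1) by (simp add: chord_words_iff)
  have "ends_on (Suc i) (ws' ! i) = image_mset (map_prod f id) (ends_on (Suc i) (ws ! i))" if "i < m" for i
  proof -
    from assms(4)[OF that] obtain k where "ws' ! i = rotate k (map f (ws ! i))" ..
    then show ?thesis unfolding ends_on_map[symmetric] by (simp add: ends_on_def mset_rotate)
  qed
  then have "word_ends ws' = image_mset (map_prod f id) (word_ends ws)"
    by (simp add: word_ends_def image_mset_sum l assms(3))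
  then have "ws' \<in> chord_words m"
    using assms(1,2,3) by (simp only: chord_words_iff balanced_relabel labels_word_ends)
  with assms show ?thesis unfolding diagram_iso_def by blast
qed

lemma rotate_inverse: "\<exists>l. rotate l (rotate k xs) = xs"
proof (cases "xs = []")
  case False
  \<comment> \<open>The total rotation is by \<open>k * length xs\<close>, a multiple of the
    length.\<close>
  have "rotate (k * (length xs - 1)) (rotate k xs) = rotate (k * length xs) xs"
    using False by (cases xs) (auto simp: rotate_rotate algebra_simps)
  also have "\<dots> = xs" by (simp add: rotate_conv_mod[of "k * length xs"])
  finally show ?thesis ..
qed simp

lemma equiv_diagram_iso: "equiv (chord_words m) (diagram_iso m)"
proof (rule equivI)
  show "diagram_iso m \<subseteq> chord_words m \<times> chord_words m"
    by (auto simp: diagram_iso_def)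
  show "refl_on (chord_words m) (diagram_iso m)"
  proof (rule refl_onI)
    fix ws assume "ws \<in> chord_words m"
    then show "(ws, ws) \<in> diagram_iso m"
      by (rule diagram_iso_relabel[where f = "\<lambda>x. x"])
        (auto simp: \<open>ws \<in> chord_words m\<close>[unfolded chord_words_iff] intro: exI[of _ 0])
  qed
  show "sym (diagram_iso m)"
  proof (rule symI)
    fix ws ws' assume "(ws, ws') \<in> diagram_iso m"
    then obtain f where f: "inj_on f (set (concat ws))"
      and r: "\<And>i. i < m \<Longrightarrow> \<exists>k. ws' ! i = rotate k (map f (ws ! i))"
      and w: "ws \<in> chord_words m" "ws' \<in> chord_words m"
      unfolding diagram_iso_def by auto
    then have l: "length ws = m" "length ws' = m" by (simp_all add: chord_words_iff)
    let ?g = "the_inv_into (set (concat ws)) f"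
    have ri: "\<exists>k. ws ! i = rotate k (map ?g (ws' ! i))" if "i < m" for i
    proof -
      from r[OF that] obtain k where k: "ws' ! i = rotate k (map f (ws ! i))" ..
      have "ws ! i \<in> set ws" using that l by simp
      then have "set (ws ! i) \<subseteq> set (concat ws)" by auto
      then have "map ?g (map f (ws ! i)) = ws ! i"
        by (auto simp: the_inv_into_f_f[OF f] subset_iff intro!: map_idI simp del: set_concat)
      then have "map ?g (ws' ! i) = rotate k (ws ! i)"
        by (simp only: k rotate_map[symmetric])
      then show ?thesis using rotate_inverse[of k "ws ! i"] by metis
    qed
    have sub: "set (ws' ! i) \<subseteq> f ` set (concat ws)" if "i < m" for i
    proof -
      from r[OF that] obtain k where "ws' ! i = rotate k (map f (ws ! i))" ..
      moreover have "ws ! i \<in> set ws" using that l(1) by simp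
      ultimately show ?thesis by auto
    qed
    have "set (concat ws') \<subseteq> f ` set (concat ws)"
    proof
      fix x assume "x \<in> set (concat ws')"
      then obtain i where "i < m" "x \<in> set (ws' ! i)"
        using l(2) by (auto simp: in_set_conv_nth[of _ ws'])
      with sub show "x \<in> f ` set (concat ws)" by blast
    qed
    then have "inj_on ?g (set (concat ws'))"
      using inj_on_the_inv_into[OF f] inj_on_subset by blast
    then show "(ws', ws) \<in> diagram_iso m"
      using w(2) l(1) ri by (intro diagram_iso_relabel)
  qed
  show "trans (diagram_iso m)"
  proof (rule transI)
    fix ws ws' ws'' assume "(ws, ws') \<in> diagram_iso m" "(ws', ws'') \<in> diagram_iso m"
    then obtain f g where f: "inj_on f (set (concat ws))" and g: "inj_on g (set (concat ws'))"
      and r: "\<And>i. i < m \<Longrightarrow> \<exists>k. ws' ! i = rotate k (map f (ws ! i))"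
      and r': "\<And>i. i < m \<Longrightarrow> \<exists>k. ws'' ! i = rotate k (map g (ws' ! i))"
      and w: "ws \<in> chord_words m" "ws' \<in> chord_words m" "ws'' \<in> chord_words m"
      unfolding diagram_iso_def by auto
    then have l: "length ws = m" "length ws' = m" "length ws'' = m" by (simp_all add: chord_words_iff)
    have "f ` set (ws ! i) = set (ws' ! i)" if "i < m" for i
      using r[OF that] by auto
    then have "f ` set (concat ws) \<subseteq> set (concat ws')"
      using l by (auto simp: in_set_conv_nth[of _ ws]) (metis imageI nth_mem)
    then have "inj_on (g \<circ> f) (set (concat ws))"
      using f g by (intro comp_inj_on inj_on_subset[OF g])
    moreover have "\<exists>k. ws'' ! i = rotate k (map (g \<circ> f) (ws ! i))" if "i < m" for i
      using r[OF that] r'[OF that] by (auto simp: rotate_map rotate_rotate)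
    ultimately show "(ws, ws'') \<in> diagram_iso m"
      using w(1) l(3) by (intro diagram_iso_relabel)
  qed
qed

text \<open>Outside \<open>chord_words\<close> the relation is undefined and
  \<open>diagram_of\<close> is the empty set, which is not an equivalence class.\<close>

lemma diagram_of_in_chord_diagrams: "diagram_of m ws \<in> chord_diagrams m \<longleftrightarrow> ws \<in> chord_words m"
proof
  assume "diagram_of m ws \<in> chord_diagrams m"
  then have "diagram_of m ws \<noteq> {}"
    using in_quotient_imp_non_empty[OF equiv_diagram_iso] by (auto simp: chord_diagrams_def)
  then show "ws \<in> chord_words m" by (auto simp: diagram_of_def diagram_iso_def)
qed (auto simp: chord_diagrams_def diagram_of_def intro: quotientI)

lemma mem_diagram_of: "ws' \<in> diagram_of m ws \<longleftrightarrow> (ws, ws') \<in> diagram_iso m"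
  by (simp add: diagram_of_def)

lemma self_mem_diagram_of: "ws \<in> chord_words m \<Longrightarrow> ws \<in> diagram_of m ws"
  unfolding diagram_of_def by (rule equiv_class_self[OF equiv_diagram_iso])

lemma partners_sum: "partners (sum g A) x = (\<Sum>i\<in>A. partners (g i) x)"
  by (induction A rule: infinite_finite_induct) (auto simp: partners_add, simp_all add: partners_def)

lemma count_partners_word_ends:
  assumes "1 \<le> c" "c \<le> length ws"
  shows "count (partners (word_ends ws) x) c = count_list (ws ! (c - 1)) x"
proof -
  obtain d where d: "c = Suc d" "d < length ws" using assms by (cases c) auto
  have "count (partners (word_ends ws) x) c = (\<Sum>i<length ws. if i = d then count_list (ws ! i) x else 0)"
    unfolding word_ends_def partners_sum count_sum
    by (intro sum.cong) (auto simp: partners_ends_on d)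
  then show ?thesis using d by simp
qed

lemma set_partners_word_ends: "set_mset (partners (word_ends ws) x) \<subseteq> {1..length ws}"
  unfolding word_ends_def partners_sum by (auto simp: set_mset_sum partners_ends_on split: if_splits)

lemma size_2_cases:
  assumes "size M = 2"
  obtains a b where "M = {#a, b#}"
proof -
  obtain a N where M: "M = add_mset a N" using assms by (cases M) auto
  then obtain b where "N = {#b#}" using assms size_1_singleton_mset[of N] by auto
  with M that show thesis by blast
qed

text \<open>The right-hand side mirrors the case distinction in
  \<open>chords_of_type\<close>.\<close>

lemma size_2_eq_iff:
  assumes "size M = 2"
  shows "M = {#i, j#} \<longleftrightarrow> (if i = j then count M i = 2 else i \<in># M \<and> j \<in># M)"
proof -
  obtain a b where M: "M = {#a, b#}"
    using assms by (rule size_2_cases)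
  show ?thesis unfolding M by (auto simp: add_eq_conv_ex)
qed

lemma count_image_mset_set:
  "finite A \<Longrightarrow> count (image_mset f (mset_set A)) p = card {x \<in> A. f x = p}"
proof (induction A rule: finite_induct)
  case (insert x A)
  have "{y \<in> insert x A. f y = p} = (if f x = p then insert x {y \<in> A. f y = p} else {y \<in> A. f y = p})"
    by auto
  with insert show ?case by simp
qed simp

lemma card_chords_of_type:
  assumes ws: "ws \<in> chord_words m" and ij: "i \<in> {1..m}" "j \<in> {1..m}"
  shows "card (chords_of_type ws i j) = count (types (word_ends ws)) {#i, j#}"
proof -
  let ?K = "word_ends ws"
  have l: "length ws = m" and b: "balanced ?K" using ws by (auto simp: chord_words_iff)
  have pos: "0 < count_list w x \<longleftrightarrow> x \<in> set w" for w and x :: nat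
    by (metis count_list_0_iff neq0_conv)
  have "chords_of_type ws i j = {x \<in> fst ` set_mset ?K. partners ?K x = {#i, j#}}"
  proof (intro set_eqI iffI)
    fix x assume x: "x \<in> {x \<in> fst ` set_mset ?K. partners ?K x = {#i, j#}}"
    then have "size (partners ?K x) = 2" by simp
    from size_2_eq_iff[OF this] x ij l show "x \<in> chords_of_type ws i j"
      by (auto simp: chords_of_type_def count_partners_word_ends pos
        simp flip: count_greater_zero_iff)
  next
    fix x assume x: "x \<in> chords_of_type ws i j"
    then have "x \<in> set (ws ! (i - 1))"
      by (auto simp: chords_of_type_def split: if_splits intro: ccontr)
    then have xl: "x \<in> set (concat ws)" using ij l by (auto intro!: bexI[of _ "ws ! (i - 1)"])
    then have "size (partners ?K x) = 2" using b by (simp only: balanced_def labels_word_ends)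
    from size_2_eq_iff[OF this] x ij l have "partners ?K x = {#i, j#}"
      by (auto simp: chords_of_type_def count_partners_word_ends pos
        simp flip: count_greater_zero_iff split: if_splits)
    with xl show "x \<in> {x \<in> fst ` set_mset ?K. partners ?K x = {#i, j#}}"
      by (simp only: labels_word_ends mem_Collect_eq simp_thms)
  qed
  then show ?thesis
    by (simp add: types_def count_image_mset_set)
qed

section \<open>The monomial that belongs to a matrix\<close>

definition types_matrix :: "nat \<Rightarrow> (nat \<Rightarrow> nat \<Rightarrow> nat) \<Rightarrow> nat multiset multiset" where
  "types_matrix m S = (\<Sum>(i, j) | 1 \<le> i \<and> i \<le> j \<and> j \<le> m. replicate_mset (S i j) {#i, j#})"

lemma finite_pairs [simp]: "finite {(i, j). Suc 0 \<le> i \<and> i \<le> j \<and> j \<le> (m::nat)}"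
  by (rule finite_subset[of _ "{..m} \<times> {..m}"]) auto

lemma pair_mset_eq_iff: "{#i, j#} = {#k, l#} \<longleftrightarrow> i = k \<and> j = l \<or> i = l \<and> j = k"
  by (auto simp: add_eq_conv_ex)

lemma count_types_matrix_le:
  assumes "1 \<le> i" "i \<le> j" "j \<le> m"
  shows "count (types_matrix m S) {#i, j#} = S i j"
proof -
  have "count (types_matrix m S) {#i, j#} =
      (\<Sum>q\<in>{(i, j). 1 \<le> i \<and> i \<le> j \<and> j \<le> m}. if q = (i, j) then S i j else 0)"
    unfolding types_matrix_def count_sum
    using assms by (intro sum.cong) (auto simp: pair_mset_eq_iff split: if_splits)
  also have "\<dots> = S i j" using assms by (subst sum.delta) auto
  finally show ?thesis .
qed

lemma count_types_matrix:
  assumes "\<forall>i\<in>{1..m}. \<forall>j\<in>{1..m}. S i j = S j i" "i \<in> {1..m}" "j \<in> {1..m}"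
  shows "count (types_matrix m S) {#i, j#} = S i j"
proof (cases "i \<le> j")
  case True
  then show ?thesis using assms by (simp add: count_types_matrix_le)
next
  case False
  then have "count (types_matrix m S) {#j, i#} = S j i" using assms by (simp add: count_types_matrix_le)
  then show ?thesis using assms by (simp add: add_mset_commute)
qed

lemma set_types_matrix: "p \<in># types_matrix m S \<Longrightarrow> \<exists>i j. 1 \<le> i \<and> i \<le> j \<and> j \<le> m \<and> p = {#i, j#}"
  unfolding types_matrix_def by (auto simp: set_mset_sum split: if_splits)

text \<open>The counts at pairs of circles determine the multiset, because each chord has two ends,
  both on circles between 1 and \<open>m\<close>, so no other type occurs.\<close>

lemma types_word_ends_eq_iff:
  assumes ws: "ws \<in> chord_words m" and S: "\<forall>i\<in>{1..m}. \<forall>j\<in>{1..m}. S i j = S j i"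
  shows "types (word_ends ws) = types_matrix m S \<longleftrightarrow>
    (\<forall>i\<in>{1..m}. \<forall>j\<in>{1..m}. count (types (word_ends ws)) {#i, j#} = S i j)" (is "?L \<longleftrightarrow> ?R")
proof
  assume ?L
  then show ?R using count_types_matrix[OF S] by simp
next
  assume R: ?R
  have in_range: "\<exists>i\<in>{1..m}. \<exists>j\<in>{1..m}. p = {#i, j#}" if "p \<in># types (word_ends ws)" for p
  proof -
    from that obtain x where x: "x \<in> fst ` set_mset (word_ends ws)" and p: "p = partners (word_ends ws) x"
      unfolding types_def by auto
    from x ws have "size p = 2" unfolding p by (simp only: chord_words_iff balanced_def)
    then obtain a b where "p = {#a, b#}"
      by (rule size_2_cases)
    moreover have "set_mset p \<subseteq> {1..m}"
      using set_partners_word_ends[of ws x] ws by (simp add: p chord_words_iff)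
    ultimately show ?thesis by (intro bexI[of _ a] bexI[of _ b]) auto
  qed
  show ?L
  proof (rule multiset_eqI)
    fix p
    show "count (types (word_ends ws)) p = count (types_matrix m S) p"
    proof (cases "\<exists>i\<in>{1..m}. \<exists>j\<in>{1..m}. p = {#i, j#}")
      case True
      then show ?thesis using R count_types_matrix[OF S] by auto
    next
      case False
      then have "p \<notin># types (word_ends ws)" "p \<notin># types_matrix m S"
        using in_range set_types_matrix[of p m S] by fastforce+
      then show ?thesis by (simp add: not_in_iff)
    qed
  qed
qed

text \<open>The types are invariant under \<open>diagram_iso\<close>, so the condition on all
  representatives can be tested on one of them.\<close>

lemma diagram_of_type_iff:
  assumes S: "\<forall>i\<in>{1..m}. \<forall>j\<in>{1..m}. S i j = S j i"
  shows "diagram_of m ws \<in> diagrams_of_type m S \<longleftrightarrow>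
    ws \<in> chord_words m \<and> types (word_ends ws) = types_matrix m S"
proof (cases "ws \<in> chord_words m")
  case True
  have "card (chords_of_type ws' i j) = count (types (word_ends ws)) {#i, j#}"
    if "(ws, ws') \<in> diagram_iso m" "i \<in> {1..m}" "j \<in> {1..m}" for ws' i j
  proof -
    from that(1) have "ws' \<in> chord_words m" by (auto simp: diagram_iso_def)
    from card_chords_of_type[OF this that(2,3)] show ?thesis
      by (simp add: diagram_iso_types[OF that(1)])
  qed
  moreover have "(ws, ws) \<in> diagram_iso m"
    using self_mem_diagram_of[OF True] by (simp add: mem_diagram_of)
  ultimately show ?thesis
    using True types_word_ends_eq_iff[OF True S]
    by (auto simp: diagrams_of_type_def diagram_of_in_chord_diagrams mem_diagram_of)
qed (auto simp: diagrams_of_type_def diagram_of_in_chord_diagrams)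

section \<open>Degree and finiteness\<close>

lemma size_balanced:
  assumes "balanced K"
  shows "size K = 2 * size (types K)" "card (fst ` set_mset K) = size (types K)"
proof -
  show c: "card (fst ` set_mset K) = size (types K)" by (simp add: types_def)
  have "size K = size (image_mset fst K)" by simp
  also have "\<dots> = (\<Sum>x\<in>set_mset (image_mset fst K). count (image_mset fst K) x)"
    by (rule size_multiset_overloaded_eq)
  also have "\<dots> = (\<Sum>x\<in>fst ` set_mset K. size (partners K x))"
    by (simp only: size_partners set_image_mset)
  also have "\<dots> = 2 * card (fst ` set_mset K)"
    using assms[unfolded balanced_def] by (simp only: sum.cong[OF refl, of _ "\<lambda>x. size (partners K x)" "\<lambda>_. 2"]) simp
  finally show "size K = 2 * size (types K)" by (simp add: c)
qed

lemma length_concat_chord_word: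
  assumes "ws \<in> chord_words m"
  shows "length (concat ws) = 2 * size (types (word_ends ws))"
proof -
  have "length (concat ws) = size (word_ends ws)"
    using arg_cong[OF image_fst_word_ends[of ws], of size] by simp
  with size_balanced(1) assms show ?thesis by (simp add: chord_words_iff)
qed

lemma degree_of_type:
  assumes S: "\<forall>i\<in>{1..m}. \<forall>j\<in>{1..m}. S i j = S j i" and D: "D \<in> diagrams_of_type m S"
  shows "diagram_degree D = size (types_matrix m S)"
proof -
  from D obtain ws where ws: "ws \<in> chord_words m" "D = diagram_of m ws"
    by (auto simp: diagrams_of_type_def chord_diagrams_def diagram_of_def elim: quotientE)
  with D S have t: "types (word_ends ws) = types_matrix m S" by (simp add: diagram_of_type_iff)
  let ?w = "SOME ws. ws \<in> D"
  have "?w \<in> D" using self_mem_diagram_of[OF ws(1)] ws(2) by (auto intro: someI)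
  then have iso: "(ws, ?w) \<in> diagram_iso m" using ws(2) by (simp add: mem_diagram_of)
  then have "?w \<in> chord_words m" by (auto simp: diagram_iso_def)
  from length_concat_chord_word[OF this] diagram_iso_types[OF iso] t show ?thesis
    by (simp add: diagram_degree_def)
qed

text \<open>All these diagrams have \<open>N\<close> chords. Relabelling the chords by 0, ..., N - 1
  gives representatives with letters below \<open>N\<close> and words of length at most
  \<open>2 * N\<close>.\<close>

lemma finite_diagrams_of_type:
  assumes S: "\<forall>i\<in>{1..m}. \<forall>j\<in>{1..m}. S i j = S j i"
  shows "finite (diagrams_of_type m S)"
proof -
  define N where "N = size (types_matrix m S)"
  let ?W = "{w. set w \<subseteq> {..<N} \<and> length w \<le> 2 * N}"
  let ?F = "{ws. set ws \<subseteq> ?W \<and> length ws = m}"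
  have "finite ?F" by (intro finite_lists_length_eq finite_lists_length_le) simp
  moreover have "diagrams_of_type m S \<subseteq> diagram_of m ` ?F"
  proof
    fix D assume D: "D \<in> diagrams_of_type m S"
    then obtain ws where ws: "ws \<in> chord_words m" "D = diagram_of m ws"
      by (auto simp: diagrams_of_type_def chord_diagrams_def diagram_of_def elim: quotientE)
    with D S have t: "types (word_ends ws) = types_matrix m S" by (simp add: diagram_of_type_iff)
    have b: "balanced (word_ends ws)" and l: "length ws = m" using ws by (simp_all add: chord_words_iff)
    have c: "card (set (concat ws)) = N"
      using size_balanced(2)[OF b] unfolding labels_word_ends t N_def .
    then obtain f where f: "bij_betw f (set (concat ws)) {..<N}"
      using ex_bij_betw_finite_nat[OF finite_set[of "concat ws"]] by (auto simp: lessThan_atLeast0 simp del: set_concat)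
    let ?ws = "map (map f) ws"
    have "(ws, ?ws) \<in> diagram_iso m"
    proof (rule diagram_iso_relabel[OF ws(1)])
      show "inj_on f (set (concat ws))" using f by (rule bij_betw_imp_inj_on)
      show "\<exists>k. ?ws ! i = rotate k (map f (ws ! i))" if "i < m" for i
        using that l by (intro exI[of _ 0]) simp
    qed (simp add: l)
    then have "D = diagram_of m ?ws"
      unfolding ws(2) diagram_of_def by (rule equiv_class_eq[OF equiv_diagram_iso])
    moreover have "?ws \<in> ?F"
    proof -
      have "map f w \<in> ?W" if "w \<in> set ws" for w
      proof (intro CollectI conjI)
        have "set w \<subseteq> set (concat ws)" using that by auto
        then show "set (map f w) \<subseteq> {..<N}" using bij_betw_imp_surj_on[OF f] by (simp del: set_concat) blast
        have "length w \<le> length (concat ws)" using that by (auto simp: length_concat member_le_sum_list)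
        also have "\<dots> = 2 * N" using length_concat_chord_word[OF ws(1)] t by (simp add: N_def)
        finally show "length (map f w) \<le> 2 * N" by simp
      qed
      then have "set ?ws \<subseteq> ?W" unfolding set_map by (rule image_subsetI)
      then show ?thesis using l by simp
    qed
    ultimately show "D \<in> diagram_of m ` ?F" by blast
  qed
  ultimately show ?thesis by (meson finite_imageI finite_subset)
qed

section \<open>The 4T relation\<close>

lemma sum_basis: "finite A \<Longrightarrow> (\<Sum>D\<in>A. basis X D) = (if X \<in> A then 1 else 0)"
  by (simp add: basis_def)

lemma word_ends_replace_letter:
  "word_ends (map (replace_letter p [q, r]) ws) = word_ends (map (replace_letter p [r, q]) ws)"
proof -
  have "mset (replace_letter p [q, r] w) = mset (replace_letter p [r, q] w)" for w
    by (induction w) auto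
  then show ?thesis by (simp add: word_ends_def ends_on_def)
qed

lemma sum_four_T_null:
  assumes S: "\<forall>i\<in>{1..m}. \<forall>j\<in>{1..m}. S i j = S j i" and g: "g \<in> four_T_null m"
  shows "(\<Sum>D\<in>diagrams_of_type m S. g D) = 0"
proof -
  let ?D = "diagrams_of_type m S"
  let ?N = "size (types_matrix m S)"
  \<comment> \<open>Being a chord word and having given types both depend on
    \<open>word_ends\<close> alone, so the two diagrams of a pair lie in the set together or not at
    all.\<close>
  have same: "diagram_of m (map (replace_letter p [q, r]) ws) \<in> ?D \<longleftrightarrow>
      diagram_of m (map (replace_letter p [r, q]) ws) \<in> ?D" for p q r ws
    unfolding diagram_of_type_iff[OF S] chord_words_iff word_ends_replace_letter[of p q r] by simp
  have rel: "(\<Sum>D\<in>?D. h D) = 0" if "h \<in> four_T_relators m" for h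
  proof -
    from that obtain ws p q r where h: "h = basis (diagram_of m (map (replace_letter p [q, r]) ws))
     - basis (diagram_of m (map (replace_letter p [r, q]) ws))
     + basis (diagram_of m (map (replace_letter q [p, r]) ws))
     - basis (diagram_of m (map (replace_letter q [r, p]) ws))"
      unfolding four_T_relators_def by auto
    show ?thesis
      unfolding h plus_fun_apply minus_apply sum.distrib sum_subtractf
      by (simp add: sum_basis finite_diagrams_of_type[OF S] same[of p q r] same[of q p r])
  qed
  have span: "(\<Sum>D\<in>?D. h D) = 0" if "h \<in> rat_fun.span (four_T_relators m)" for h
    using that
  proof (induction rule: rat_fun.span_induct_alt)
    case base
    show ?case by simp
  next
    case (step c x y)
    then show ?case by (simp add: sum.distrib rel flip: sum_distrib_left)
  qed
  \<comment> \<open>\<open>four_T_null\<close> controls each homogeneous part separately. Diagrams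
    of one type matrix all have degree \<open>?N\<close>, so the sum only sees that part, which lies
    in the span.\<close>
  have "(\<Sum>D\<in>?D. g D) = (\<Sum>D\<in>?D. hom_part diagram_degree ?N g D)"
    by (intro sum.cong) (auto simp: hom_part_def degree_of_type[OF S])
  also have "\<dots> = 0" using g by (intro span) (simp add: four_T_null_def)
  finally show ?thesis .
qed

lemma coeff_sum_A_class:
  assumes S: "\<forall>i\<in>{1..m}. \<forall>j\<in>{1..m}. S i j = S j i"
  shows "coeff_sum (diagrams_of_type m S) (A_class m f) = (\<Sum>D\<in>diagrams_of_type m S. f D)"
  unfolding coeff_sum_def
proof (rule the_equality)
  \<comment> \<open>Hence \<open>f\<close> lies in its own class. The class is nonempty, and this
    makes the value described by \<open>THE\<close> unique.\<close>
  have "0 \<in> four_T_null m"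
  proof -
    have "hom_part diagram_degree n (0 :: chord_diagram \<Rightarrow> rat) = 0" for n by (auto simp: hom_part_def)
    then show ?thesis by (simp add: four_T_null_def rat_fun.span_zero)
  qed
  then have f: "f \<in> A_class m f" by (simp add: A_class_def)
  show "\<forall>h\<in>A_class m f. (\<Sum>D\<in>diagrams_of_type m S. h D) = (\<Sum>D\<in>diagrams_of_type m S. f D)"
  proof
    fix h assume "h \<in> A_class m f"
    then have "h - f \<in> four_T_null m" by (simp only: A_class_def mem_Collect_eq)
    from sum_four_T_null[OF S this] show "(\<Sum>D\<in>diagrams_of_type m S. h D) = (\<Sum>D\<in>diagrams_of_type m S. f D)"
      by (simp add: sum_subtractf)
  qed
  then show "c = (\<Sum>D\<in>diagrams_of_type m S. f D)"
    if "\<forall>h\<in>A_class m f. (\<Sum>D\<in>diagrams_of_type m S. h D) = c" for c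
    using that f by auto
qed

section \<open>Closed tangles\<close>

text \<open>Without boundary points there are no arcs, so all ends lie on circles. The component
  numbers of the circles are those of the skeleton, each of 1, ..., m once, so the lookups by
  \<open>map_of\<close> meet every circle exactly once.\<close>

lemma closed_diagram_word_ends:
  assumes "framed_link m L" "has_shape L n E"
  defines "ws \<equiv> map (\<lambda>i. the (map_of (snd E) i)) [1..<Suc m]"
  shows "word_ends ws = ends E" "ws \<in> chord_words m"
proof -
  have e: "erase E = skeleton L" using assms(2) by (simp add: has_shape_def)
  have "ported {#} {#} E"
    using has_shape_bounded[OF _ assms(2)] assms(1) by (simp add: framed_link_def bounded_by_def)
  then have as: "fst E = []" by (simp add: ported_def)
  have "map fst (snd E) = map fst (snd (skeleton L))"
    unfolding e[symmetric] by (simp add: erase_def case_prod_beta comp_def)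
  then have d: "distinct (map fst (snd E))" and s: "fst ` set (snd E) = {1..m}"
    using assms(1) by (auto simp: framed_link_def simp flip: set_map)
  have "word_ends ws = (\<Sum>i<m. ends_on (Suc i) (the (map_of (snd E) (Suc i))))"
    unfolding word_ends_def ws_def by (intro sum.cong) (auto simp del: upt_Suc)
  also have "\<dots> = (\<Sum>i\<in>{1..m}. ends_on i (the (map_of (snd E) i)))"
    by (rule sum.reindex_bij_witness[of _ "\<lambda>i. i - 1" Suc]) auto
  also have "\<dots> = (\<Sum>q\<in>set (snd E). ends_on (fst q) (the (map_of (snd E) (fst q))))"
    unfolding s[symmetric] using d by (subst sum.reindex) (auto simp: distinct_map)
  also have "\<dots> = (\<Sum>q\<in>set (snd E). ends_on (fst q) (snd q))"
    using d by (intro sum.cong) auto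
  also have "\<dots> = ends E"
    using d as by (simp add: ends_def distinct_map sum_list_distinct_conv_sum_set case_prod_beta)
  finally show w: "word_ends ws = ends E" .
  show "ws \<in> chord_words m"
    using assms(2) unfolding chord_words_iff w by (simp add: has_shape_def ws_def)
qed

lemma lookup_ev_weight:
  "Poly_Mapping.lookup (ev weight p) M = (\<Sum>E | E \<in> Poly_Mapping.keys p \<and> chord_types E = M. Poly_Mapping.lookup p E)"
proof -
  have "Poly_Mapping.lookup (ev weight p) M = (\<Sum>E\<in>Poly_Mapping.keys p. if chord_types E = M then Poly_Mapping.lookup p E else 0)"
    by (simp add: ev_def lookup_sum weight_def mult_single lookup_single when_def)
  then show ?thesis by (simp add: sum.If_cases Int_def conj_commute)
qed

lemma sum_Z_link_rep:
  assumes S: "\<forall>i\<in>{1..m}. \<forall>j\<in>{1..m}. S i j = S j i" and L: "framed_link m L"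
  shows "(\<Sum>D\<in>diagrams_of_type m S. Z_link_rep \<Phi> m L D) =
    Poly_Mapping.lookup (ev weight (Z \<Phi> L (size (types_matrix m S)))) (types_matrix m S)"
proof -
  let ?D = "diagrams_of_type m S"
  define z where "z = Z \<Phi> L (size (types_matrix m S))"
  have c: "closed_diagram m E \<in> ?D \<longleftrightarrow> chord_types E = types_matrix m S" if "E \<in> Poly_Mapping.keys z" for E
  proof -
    have "has_shape L (size (types_matrix m S)) E"
      using keys_Z that L by (auto simp: z_def framed_link_def)
    from closed_diagram_word_ends[OF L this] show ?thesis
      by (simp add: closed_diagram_def diagram_of_type_iff[OF S] chord_types_def)
  qed
  have "(\<Sum>D\<in>?D. Z_link_rep \<Phi> m L D) =
      (\<Sum>D\<in>?D. \<Sum>E | E \<in> Poly_Mapping.keys z \<and> closed_diagram m E = D. Poly_Mapping.lookup z E)"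
    by (intro sum.cong) (auto simp: Z_link_rep_def degree_of_type[OF S] z_def Let_def)
  also have "\<dots> = (\<Sum>D\<in>?D. \<Sum>E | E \<in> {E \<in> Poly_Mapping.keys z. closed_diagram m E \<in> ?D} \<and> closed_diagram m E = D.
      Poly_Mapping.lookup z E)"
    by (intro sum.cong) auto
  also have "\<dots> = (\<Sum>E | E \<in> Poly_Mapping.keys z \<and> closed_diagram m E \<in> ?D. Poly_Mapping.lookup z E)"
    \<comment> \<open>Labelled diagrams are grouped by the chord diagram that they
      represent.\<close>
    by (rule sum.group) (auto simp: finite_diagrams_of_type[OF S])
  also have "\<dots> = Poly_Mapping.lookup (ev weight z) (types_matrix m S)"
    unfolding lookup_ev_weight by (intro sum.cong) (auto simp: c)
  finally show ?thesis by (simp add: z_def)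
qed

section \<open>Coefficients of powers of a linear form\<close>

lemma lookup_single_mult:
  fixes Q :: type_ring
  shows "Poly_Mapping.lookup (Poly_Mapping.single K c * Q) M =
    (if K \<subseteq># M then c * Poly_Mapping.lookup Q (M - K) else 0)"
proof -
  have "Poly_Mapping.lookup (Poly_Mapping.single K c * Q) M = c * (\<Sum>q. Poly_Mapping.lookup Q q when M = K + q)"
    by (simp add: lookup_mult lookup_single when_mult)
  moreover have "M = K + q \<longleftrightarrow> K \<subseteq># M \<and> q = M - K" for q by auto
  ultimately show ?thesis by (simp add: when_def[of _ "_ \<and> _"])
qed

text \<open>The multinomial theorem. In the induction one factor is split off: taking the variable
  \<open>p\<close> from it leaves \<open>M - {#p#}\<close>, which costs a factor
  \<open>count M p\<close>, and these counts add up to the degree \<open>Suc n\<close>.\<close>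

lemma lookup_power_linear:
  assumes "finite P"
  shows "Poly_Mapping.lookup ((\<Sum>p\<in>P. scalar (l p) * type_var p) ^ n) M =
    (if size M = n \<and> set_mset M \<subseteq> P then fact n * (\<Prod>p\<in>P. l p ^ count M p / fact (count M p)) else 0)"
proof (induction n arbitrary: M)
  case 0
  then show ?case by (auto simp: lookup_one when_def)
next
  case (Suc n)
  let ?X = "\<Sum>p\<in>P. scalar (l p) * type_var p"
  let ?w = "\<lambda>M. \<Prod>p\<in>P. l p ^ count M p / fact (count M p)"
  have step: "l p * ?w (M - {#p#}) = of_nat (count M p) * ?w M" if p: "p \<in> P" "p \<in># M" for p
  proof -
    obtain k where k: "count M p = Suc k" using p(2) by (metis count_eq_zero_iff not0_implies_Suc)
    have "(\<Prod>q\<in>P - {p}. l q ^ count (M - {#p#}) q / fact (count (M - {#p#}) q)) =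
        (\<Prod>q\<in>P - {p}. l q ^ count M q / fact (count M q))"
      by (intro prod.cong) auto
    moreover have "l p * (l p ^ k / fact k) = of_nat (Suc k) * (l p ^ Suc k / fact (Suc k))"
      by (simp add: field_simps del: of_nat_Suc)
    ultimately show ?thesis
      using k by (simp only: prod.remove[OF assms p(1)] mult.assoc[symmetric]) simp
  qed
  have "Poly_Mapping.lookup (?X ^ Suc n) M = (\<Sum>p\<in>P. if p \<in># M then l p * Poly_Mapping.lookup (?X ^ n) (M - {#p#}) else 0)"
    by (simp only: power_Suc sum_distrib_right lookup_sum mult.assoc lookup_single_mult)
      (auto intro!: sum.cong)
  also have "\<dots> = (\<Sum>p\<in>P. if size M = Suc n \<and> set_mset M \<subseteq> P then fact n * of_nat (count M p) * ?w M else 0)"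
  proof (rule sum.cong [OF refl])
    fix p assume p: "p \<in> P"
    show "(if p \<in># M then l p * Poly_Mapping.lookup (?X ^ n) (M - {#p#}) else 0) =
        (if size M = Suc n \<and> set_mset M \<subseteq> P then fact n * of_nat (count M p) * ?w M else 0)"
    proof (cases "p \<in># M")
      case True
      then obtain M' where M': "M = add_mset p M'" by (metis mset_add)
      have "size (M - {#p#}) = n \<and> set_mset (M - {#p#}) \<subseteq> P \<longleftrightarrow> size M = Suc n \<and> set_mset M \<subseteq> P"
        using p by (simp add: M')
      with step[OF p True] True show ?thesis unfolding Suc.IH by (simp add: mult.left_commute mult.assoc)
    next
      case False
      then have "count M p = 0" by (simp add: not_in_iff)
      with False show ?thesis by simp
    qed
  qed
  also have "\<dots> = (if size M = Suc n \<and> set_mset M \<subseteq> P then fact (Suc n) * ?w M else 0)"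
  proof (cases "size M = Suc n \<and> set_mset M \<subseteq> P")
    case True
    have "(\<Sum>p\<in>P. count M p) = size M"
      unfolding size_multiset_overloaded_eq using True assms
      by (intro sum.mono_neutral_right) (auto simp: not_in_iff)
    then have "(\<Sum>p\<in>P. of_nat (count M p) :: rat) = of_nat (Suc n)"
      using True by (simp flip: of_nat_sum)
    moreover have "(\<Sum>p\<in>P. fact n * of_nat (count M p) * ?w M) = fact n * (\<Sum>p\<in>P. of_nat (count M p)) * ?w M"
      by (simp add: sum_distrib_left sum_distrib_right)
    ultimately show ?thesis using True by (simp add: mult_ac)
  next
    case False
    then show ?thesis by (simp only: if_False sum.neutral_const)
  qed
  finally show ?case .
qed

definition half_signs :: "qtangle \<Rightarrow> nat multiset \<Rightarrow> rat" where
  "half_signs L p = (\<Sum>(e, c, d)\<leftarrow>crossings L. if {#c, d#} = p then of_int e / 2 else 0)"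

lemma crossing_sum_eq:
  assumes "finite P" "\<And>e c d. (e, c, d) \<in> set (crossings L) \<Longrightarrow> {#c, d#} \<in> P"
  shows "crossing_sum L = (\<Sum>p\<in>P. scalar (half_signs L p) * type_var p)"
proof -
  have "(\<Sum>(e, c, d)\<leftarrow>cs. scalar (of_int e / 2) * type_var {#c, d#}) =
      (\<Sum>p\<in>P. scalar (\<Sum>(e, c, d)\<leftarrow>cs. if {#c, d#} = p then of_int e / 2 else 0) * type_var p)"
    if "\<And>e c d. (e, c, d) \<in> set cs \<Longrightarrow> {#c, d#} \<in> P" for cs
    using that
  proof (induction cs)
    case (Cons x cs)
    obtain e c d where x: "x = (e, c, d)" by (cases x)
    have "(\<Sum>p\<in>P. scalar (if {#c, d#} = p then of_int e / 2 else 0) * type_var p) =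
        (\<Sum>p\<in>P. if p = {#c, d#} then scalar (of_int e / 2) * type_var p else 0)"
      by (intro sum.cong) auto
    also have "\<dots> = scalar (of_int e / 2) * type_var {#c, d#}"
      using assms(1) Cons.prems[of e c d] by (simp add: x)
    finally have *: "(\<Sum>p\<in>P. scalar (if {#c, d#} = p then of_int e / 2 else 0) * type_var p) =
      scalar (of_int e / 2) * type_var {#c, d#}" .
    have IH: "(\<Sum>(e, c, d)\<leftarrow>cs. scalar (of_int e / 2) * type_var {#c, d#}) =
      (\<Sum>p\<in>P. scalar (\<Sum>(e, c, d)\<leftarrow>cs. if {#c, d#} = p then of_int e / 2 else 0) * type_var p)"
      using Cons.prems by (intro Cons.IH) auto
    show ?case
      by (simp only: x list.map sum_list.Cons case_prod_conv single_add distrib_right sum.distrib * IH)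
  qed simp
  then show ?thesis using assms(2) unfolding crossing_sum_def half_signs_def by blast
qed

text \<open>Unordered pairs treat both cases at once: for different components they admit both
  orders of the strands, as in the linking number, and for equal ones they give half the
  writhe.\<close>

lemma ell_eq_half_signs: "ell L i j = half_signs L {#i, j#}"
proof -
  have *: "of_int (\<Sum>(e, c, d)\<leftarrow>cs. if Q c d then e else 0) / 2 =
      (\<Sum>(e, c, d)\<leftarrow>cs. if Q c d then of_int e / 2 else (0::rat))" for cs and Q :: "nat \<Rightarrow> nat \<Rightarrow> bool"
    by (induction cs) (auto simp: add_divide_distrib)
  show ?thesis
    unfolding ell_def linking_number_def framing_def half_signs_def *
    by (auto simp: pair_mset_eq_iff intro!: arg_cong[where f = sum_list] map_cong)
qed

theorem theorem1:
  fixes m :: nat and L :: qtangle and S :: "nat \<Rightarrow> nat \<Rightarrow> nat" and \<Phi> :: "bool ncseries"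
  assumes "m \<ge> 1"
    and "drinfeld_associator \<Phi>"
    and "framed_link m L"
    and "\<forall>i\<in>{1..m}. \<forall>j\<in>{1..m}. S i j = S j i"
  shows "ell_matrix m S L = coeff_sum (diagrams_of_type m S) (Z_link \<Phi> m L)"
proof -
  define M where "M = types_matrix m S"
  define I where "I = {(i, j). 1 \<le> i \<and> i \<le> j \<and> j \<le> m}"
  \<comment> \<open>The first part contains all types occurring in \<open>M\<close>, the second all
    types of crossings, so that both the monomial and the linear form live over
    \<open>P\<close>.\<close>
  define P where "P = (\<lambda>(i, j). {#i, j#}) ` I \<union> (\<lambda>(e, c, d). {#c, d#}) ` set (crossings L)"
  have P: "finite P" by (simp add: P_def I_def)
  have MP: "set_mset M \<subseteq> P"
    using set_types_matrix[of _ m S] by (force simp: M_def P_def I_def)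
  let ?w = "\<lambda>p. half_signs L p ^ count M p / fact (count M p)"
  have "coeff_sum (diagrams_of_type m S) (Z_link \<Phi> m L) = Poly_Mapping.lookup (Exp (crossing_sum L) (size M)) M"
    using assms(3) unfolding Z_link_def coeff_sum_A_class[OF assms(4)] sum_Z_link_rep[OF assms(4,3)]
    by (simp add: ev_Z[OF assms(2)] framed_link_def M_def)
  also have "crossing_sum L = (\<Sum>p\<in>P. scalar (half_signs L p) * type_var p)"
    by (rule crossing_sum_eq[OF P]) (force simp: P_def)
  \<comment> \<open>The factor \<open>1 / fact (size M)\<close> of \<open>Exp\<close> cancels the
    factorial of the multinomial formula.\<close>
  also have "Poly_Mapping.lookup (Exp \<dots> (size M)) M = (\<Prod>p\<in>P. ?w p)"
    unfolding Exp_def lookup_single_mult lookup_power_linear[OF P] diff_empty using MP by simp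
  also have "\<dots> = (\<Prod>p\<in>(\<lambda>(i, j). {#i, j#}) ` I. ?w p)"
  proof (rule prod.mono_neutral_right[OF P])
    show "\<forall>p\<in>P - (\<lambda>(i, j). {#i, j#}) ` I. ?w p = 1"
    proof
      fix p assume "p \<in> P - (\<lambda>(i, j). {#i, j#}) ` I"
      then have "p \<notin># M" using set_types_matrix[of p m S] by (force simp: M_def I_def)
      \<comment> \<open>The exponent is 0, so the factor is 1 whatever the base is, by the
        convention 0^0 = 1.\<close>
      then show "?w p = 1" by (simp add: not_in_iff)
    qed
  qed (simp add: P_def)
  also have "\<dots> = (\<Prod>(i, j)\<in>I. ?w {#i, j#})"
    \<comment> \<open>Under the condition \<open>i \<le> j\<close> the unordered pair determines
      \<open>(i, j)\<close>.\<close>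
    by (subst prod.reindex) (auto simp: inj_on_def I_def pair_mset_eq_iff case_prod_beta)
  also have "\<dots> = (\<Prod>(i, j)\<in>I. 1 / fact (S i j) * ell L i j ^ S i j)"
    by (intro prod.cong) (auto simp: I_def M_def count_types_matrix_le ell_eq_half_signs)
  also have "\<dots> = ell_matrix m S L"
    by (simp add: ell_matrix_def I_def)
  finally show ?thesis by simp
qed

end
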